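(* For any given $\tau>0$ and $h>0$, there exists a solution $(u_h^n,\phi_h^n)\in\widetilde V_h\times V_h$ ($n=1,2,\dots,N$) to the fully discrete scheme (S) described in the context.
   Context: Let $\Omega\subset\mathbb{R}^d$ ($d=2,3$) be an open bounded convex polygonal ($d=2$) or polyhedral ($d=3$) domain, $T>0$, and let $\alpha,\beta\ge0$ be real constants such that either $\alpha\ne0$ and $\beta\ne0$ (Schrödinger–Helmholtz case) or $\alpha=0$ and $\beta=1$ (Schrödinger–Poisson case). Write $\mathbf i=\sqrt{-1}$. The initial data are $u_0\in H_0^1(\Omega)$ (complex-valued) and $\phi_0\in H_0^1(\Omega)$ (real-valued). The scheme below discretizes the system $\mathbf i u_t+\Delta u-\phi u=0$, $\alpha\phi-\beta^2\Delta\phi=|u|^2$ in $\Omega\times(0,T]$ with $u(\cdot,0)=u_0$, $\phi(\cdot,0)=\phi_0$ and homogeneous Dirichlet boundary conditions. Finite element spaces: $\mathcal T_h$ is a quasi-uniform partition of $\Omega$ into triangles ($d=2$) or tetrahedra ($d=3$) $\mathcal K_j$, with mesh size $h=\max_j \mathrm{diam}\,\mathcal K_j$. For a fixed integer $r\ge1$, $V_h$ is the space of real-valued functions $v_h\in C(\overline\Omega)$ with $v_h=0$ on $\partial\Omega$ whose restriction to each $\mathcal K_j$ is a polynomial of degree at most $r$, and $\widetilde V_h=V_h\oplus\mathbf i V_h$. The inner product is $(u,v)=\int_\Omega u\,v^*\,d\mathbf x$, where $v^*$ is the complex conjugate of $v$. The Ritz projection $R_h:H_0^1(\Omega)\to V_h$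 is defined by $(\nabla(v-R_hv),\nabla w_h)=0$ for all $w_h\in V_h$ (for complex-valued functions, applied to real and imaginary parts, with values in $\widetilde V_h$). Time discretization: $N$ is a positive integer, $\tau=T/N$. For a sequence $\omega^n$, $D_\tau\omega^n=(\omega^n-\omega^{n-1})/\tau$ and $\overline\omega^{\,n-\frac12}=(\omega^n+\omega^{n-1})/2$. Scheme (S): $u_h^0=R_hu_0$, $\phi_h^0=R_h\phi_0$, and for $n=1,\dots,N$, $(u_h^n,\phi_h^n)\in\widetilde V_h\times V_h$ satisfies $$\mathbf i(D_\tau u_h^n,v_h)-(\nabla\overline u_h^{\,n-\frac12},\nabla v_h)-(\overline\phi_h^{\,n-\frac12}\,\overline u_h^{\,n-\frac12},v_h)=0\quad\forall v_h\in\widetilde V_h,$$ $$\alpha(\phi_h^n,w_h)+\beta^2(\nabla\phi_h^n,\nabla w_h)=(|u_h^n|^2,w_h)\quad\forall w_h\in V_h.$$ *)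

theory Defs
  imports "HOL-Analysis.Analysis"
begin

subsection \<open>Gradients and Sobolev spaces\<close>

text \<open>
  The pointwise gradient, for real- or complex-valued \<open>f\<close>; it is an unspecified vector at points
  where \<open>f\<close> is not differentiable. For a finite element function, i.e. a continuous piecewise
  polynomial, these points lie on the element boundaries, a null set, so that \<open>grad f\<close> represents
  the (elementwise, equivalently weak) gradient of \<open>f\<close>.
\<close>
definition grad :: "(real^'d::finite \<Rightarrow> 'b::real_normed_vector) \<Rightarrow> real^'d \<Rightarrow> 'b^'d" where
  "grad f x = (\<chi> i. frechet_derivative f (at x) (axis i 1))"

definition partial_deriv :: "'d::finite \<Rightarrow> (real^'d \<Rightarrow> real) \<Rightarrow> real^'d \<Rightarrow> real" where
  "partial_deriv i f x = grad f x $ i"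

text \<open>\<open>C\<^sup>\<infinity>\<close> as: all iterated partial derivatives exist and are (Frechet) differentiable.\<close>
definition smooth :: "(real^'d::finite \<Rightarrow> real) \<Rightarrow> bool" where
  "smooth f \<longleftrightarrow> (\<forall>ds. foldr partial_deriv ds f differentiable_on UNIV)"

definition test_functions :: "(real^'d::finite) set \<Rightarrow> (real^'d \<Rightarrow> real) set" where
  "test_functions \<Omega> =
     {f. smooth f \<and> compact (closure {x. f x \<noteq> 0}) \<and> closure {x. f x \<noteq> 0} \<subseteq> \<Omega>}"

definition L2 :: "(real^'d::finite) set \<Rightarrow> (real^'d \<Rightarrow> real) set" where
  "L2 \<Omega> = {f. f \<in> borel_measurable (lebesgue_on \<Omega>) \<and> integrable (lebesgue_on \<Omega>) (\<lambda>x. (f x)\<^sup>2)}"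

definition has_weak_gradient ::
    "(real^'d::finite) set \<Rightarrow> (real^'d \<Rightarrow> real) \<Rightarrow> (real^'d \<Rightarrow> real^'d) \<Rightarrow> bool" where
  "has_weak_gradient \<Omega> v g \<longleftrightarrow>
     (\<forall>i. (\<lambda>x. g x $ i) \<in> L2 \<Omega>) \<and>
     (\<forall>f\<in>test_functions \<Omega>. \<forall>i.
        (LINT x|lebesgue_on \<Omega>. v x * grad f x $ i) = - (LINT x|lebesgue_on \<Omega>. g x $ i * f x))"

text \<open>A representative; weak gradients are unique up to null sets.\<close>
definition weak_grad :: "(real^'d::finite) set \<Rightarrow> (real^'d \<Rightarrow> real) \<Rightarrow> real^'d \<Rightarrow> real^'d" where
  "weak_grad \<Omega> v = (SOME g. has_weak_gradient \<Omega> v g)"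

definition H1 :: "(real^'d::finite) set \<Rightarrow> (real^'d \<Rightarrow> real) set" where
  "H1 \<Omega> = {v \<in> L2 \<Omega>. \<exists>g. has_weak_gradient \<Omega> v g}"

text \<open>The closure of the test functions in the \<open>H\<^sup>1\<close> norm.\<close>
definition H10 :: "(real^'d::finite) set \<Rightarrow> (real^'d \<Rightarrow> real) set" where
  "H10 \<Omega> = {v \<in> H1 \<Omega>. \<exists>f :: nat \<Rightarrow> real^'d \<Rightarrow> real.
     (\<forall>k. f k \<in> test_functions \<Omega>) \<and>
     (\<lambda>k. LINT x|lebesgue_on \<Omega>. (v x - f k x)\<^sup>2) \<longlonglongrightarrow> 0 \<and>
     (\<lambda>k. LINT x|lebesgue_on \<Omega>. (norm (weak_grad \<Omega> v x - grad (f k) x))\<^sup>2) \<longlonglongrightarrow> 0}"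

definition H10_complex :: "(real^'d::finite) set \<Rightarrow> (real^'d \<Rightarrow> complex) set" where
  "H10_complex \<Omega> = {u. (\<lambda>x. Re (u x)) \<in> H10 \<Omega> \<and> (\<lambda>x. Im (u x)) \<in> H10 \<Omega>}"


subsection \<open>Inner products on \<open>\<Omega>\<close>\<close>

definition ip_real :: "(real^'d::finite) set \<Rightarrow> (real^'d \<Rightarrow> real) \<Rightarrow> (real^'d \<Rightarrow> real) \<Rightarrow> real" where
  "ip_real \<Omega> v w = (LINT x|lebesgue_on \<Omega>. v x * w x)"

definition ip_vec :: "(real^'d::finite) set \<Rightarrow> (real^'d \<Rightarrow> real^'d) \<Rightarrow> (real^'d \<Rightarrow> real^'d) \<Rightarrow> real" where
  "ip_vec \<Omega> g k = (LINT x|lebesgue_on \<Omega>. g x \<bullet> k x)"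

definition ip_complex ::
    "(real^'d::finite) set \<Rightarrow> (real^'d \<Rightarrow> complex) \<Rightarrow> (real^'d \<Rightarrow> complex) \<Rightarrow> complex" where
  "ip_complex \<Omega> u v = (LINT x|lebesgue_on \<Omega>. u x * cnj (v x))"

definition ip_complex_vec ::
    "(real^'d::finite) set \<Rightarrow> (real^'d \<Rightarrow> complex^'d) \<Rightarrow> (real^'d \<Rightarrow> complex^'d) \<Rightarrow> complex" where
  "ip_complex_vec \<Omega> g k = (LINT x|lebesgue_on \<Omega>. (\<Sum>i\<in>UNIV. g x $ i * cnj (k x $ i)))"


subsection \<open>Domain, meshes and finite element spaces\<close>

definition convex_polytopal_domain :: "(real^'d::finite) set \<Rightarrow> bool" where
  "convex_polytopal_domain \<Omega> \<longleftrightarrow>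
     open \<Omega> \<and> \<Omega> \<noteq> {} \<and> bounded \<Omega> \<and> convex \<Omega> \<and> polytope (closure \<Omega>)"

text \<open>
  A partition into nondegenerate closed simplices that overlap only in their boundaries. Hanging
  nodes are not excluded.
\<close>
definition simplicial_partition :: "(real^'d::finite) set \<Rightarrow> (real^'d) set set \<Rightarrow> bool" where
  "simplicial_partition \<Omega> \<T> \<longleftrightarrow>
     finite \<T> \<and> (\<forall>K\<in>\<T>. int CARD('d) simplex K) \<and> \<Union>\<T> = closure \<Omega> \<and>
     (\<forall>K\<in>\<T>. \<forall>K'\<in>\<T>. K \<noteq> K' \<longrightarrow> interior K \<inter> interior K' = {})"

definition mesh_size :: "(real^'d::finite) set set \<Rightarrow> real" where
  "mesh_size \<T> = Max (diameter ` \<T>)"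

text \<open>
  A family of partitions \<open>\<T> h\<close> indexed by their mesh sizes \<open>h \<in> H\<close>. Quasi-uniformity: every element
  contains a ball of radius comparable to the global mesh size, uniformly over the family.
\<close>
definition quasi_uniform_family ::
    "(real^'d::finite) set \<Rightarrow> real set \<Rightarrow> (real \<Rightarrow> (real^'d) set set) \<Rightarrow> bool" where
  "quasi_uniform_family \<Omega> H \<T> \<longleftrightarrow>
     (\<forall>h\<in>H. h > 0 \<and> simplicial_partition \<Omega> (\<T> h) \<and> mesh_size (\<T> h) = h) \<and>
     (\<exists>\<sigma>>0. \<forall>h\<in>H. \<forall>K\<in>\<T> h. \<exists>x. cball x (\<sigma> * h) \<subseteq> K)"

definition polynomial_on :: "nat \<Rightarrow> (real^'d::finite) set \<Rightarrow> (real^'d \<Rightarrow> real) \<Rightarrow> bool" where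
  "polynomial_on r K v \<longleftrightarrow>
     (\<exists>c :: ('d \<Rightarrow> nat) \<Rightarrow> real. \<forall>x\<in>K.
        v x = (\<Sum>k | sum k UNIV \<le> r. c k * (\<Prod>i\<in>UNIV. x $ i ^ k i)))"

text \<open>
  Elements of \<open>V\<^sub>h\<close> are functions on the closure of \<open>\<Omega>\<close>, represented on the whole space by extension
  by zero; the condition \<open>v x = 0\<close> outside \<open>\<Omega>\<close> contains the boundary condition.
\<close>
definition fe_space ::
    "(real^'d::finite) set \<Rightarrow> (real^'d) set set \<Rightarrow> nat \<Rightarrow> (real^'d \<Rightarrow> real) set" where
  "fe_space \<Omega> \<T> r =
     {v. continuous_on (closure \<Omega>) v \<and> (\<forall>x. x \<notin> \<Omega> \<longrightarrow> v x = 0) \<and> (\<forall>K\<in>\<T>. polynomial_on r K v)}"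

definition complexify :: "('a \<Rightarrow> real) set \<Rightarrow> ('a \<Rightarrow> complex) set" where
  "complexify V =
     {(\<lambda>x. complex_of_real (a x) + \<i> * complex_of_real (b x)) | a b. a \<in> V \<and> b \<in> V}"

definition ritz ::
    "(real^'d::finite) set \<Rightarrow> (real^'d \<Rightarrow> real) set \<Rightarrow> (real^'d \<Rightarrow> real) \<Rightarrow> real^'d \<Rightarrow> real" where
  "ritz \<Omega> V v = (THE z. z \<in> V \<and> (\<forall>w\<in>V. ip_vec \<Omega> (\<lambda>x. weak_grad \<Omega> v x - grad z x) (grad w) = 0))"

definition ritz_complex ::
    "(real^'d::finite) set \<Rightarrow> (real^'d \<Rightarrow> real) set \<Rightarrow> (real^'d \<Rightarrow> complex) \<Rightarrow> real^'d \<Rightarrow> complex" where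
  "ritz_complex \<Omega> V u x =
     Complex (ritz \<Omega> V (\<lambda>y. Re (u y)) x) (ritz \<Omega> V (\<lambda>y. Im (u y)) x)"


subsection \<open>The fully discrete scheme\<close>

definition backward_diff :: "real \<Rightarrow> (nat \<Rightarrow> 'a \<Rightarrow> 'b::real_vector) \<Rightarrow> nat \<Rightarrow> 'a \<Rightarrow> 'b" where
  "backward_diff \<tau> \<omega> n x = (\<omega> n x - \<omega> (n - 1) x) /\<^sub>R \<tau>"

text \<open>The average over time levels \<open>n - 1\<close> and \<open>n\<close>, i.e. the value at \<open>n - 1/2\<close>.\<close>
definition time_avg :: "(nat \<Rightarrow> 'a \<Rightarrow> 'b::real_vector) \<Rightarrow> nat \<Rightarrow> 'a \<Rightarrow> 'b" where
  "time_avg \<omega> n x = (\<omega> n x + \<omega> (n - 1) x) /\<^sub>R 2"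

definition scheme_solution ::
    "(real^'d::finite) set \<Rightarrow> (real^'d \<Rightarrow> real) set \<Rightarrow> real \<Rightarrow> real \<Rightarrow> real \<Rightarrow> nat \<Rightarrow>
     (real^'d \<Rightarrow> complex) \<Rightarrow> (real^'d \<Rightarrow> real) \<Rightarrow>
     (nat \<Rightarrow> real^'d \<Rightarrow> complex) \<Rightarrow> (nat \<Rightarrow> real^'d \<Rightarrow> real) \<Rightarrow> bool" where
  "scheme_solution \<Omega> V \<alpha> \<beta> \<tau> N u0 \<phi>0 u \<phi> \<longleftrightarrow>
     u 0 = ritz_complex \<Omega> V u0 \<and> \<phi> 0 = ritz \<Omega> V \<phi>0 \<and>
     (\<forall>n\<in>{1..N}.
        u n \<in> complexify V \<and> \<phi> n \<in> V \<and>
        (\<forall>v\<in>complexify V.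
           \<i> * ip_complex \<Omega> (backward_diff \<tau> u n) v
           - ip_complex_vec \<Omega> (grad (time_avg u n)) (grad v)
           - ip_complex \<Omega> (\<lambda>x. complex_of_real (time_avg \<phi> n x) * time_avg u n x) v = 0) \<and>
        (\<forall>w\<in>V.
           \<alpha> * ip_real \<Omega> (\<phi> n) w + \<beta>\<^sup>2 * ip_vec \<Omega> (grad (\<phi> n)) (grad w)
           = ip_real \<Omega> (\<lambda>x. (cmod (u n x))\<^sup>2) w))"

end

theory Submission
  imports Defs "HOL-Library.Function_Algebras"
begin

text \<open>
  The initial values are Ritz projections, so they lie in the finite element space, and the
  solution is built one time level at a time. The unknowns of a step are reduced to the
  midpoint value \<open>w = (u\<^sup>n + u\<^sup>n\<^sup>-\<^sup>1) / 2\<close>: it determines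
  \<open>u\<^sup>n = 2 w - u\<^sup>n\<^sup>-\<^sup>1\<close>, and then \<open>\<phi>\<^sup>n\<close> is the unique solution of a linear
  problem whose bilinear form \<open>\<alpha> (\<cdot>, \<cdot>) + \<beta>\<^sup>2 (\<nabla>\<cdot>, \<nabla>\<cdot>)\<close> is an inner product on \<open>V\<^sub>h\<close>.
  What remains is a nonlinear equation \<open>g w v = 0\<close> for all test functions \<open>v\<close> in the
  finite-dimensional space \<open>V\<^sub>h \<times> V\<^sub>h\<close> of real and imaginary parts. Test it with \<open>v = w\<close>: the Laplacian
  and the potential, both symmetric, enter the equations for the two parts with opposite signs and cancel,
  however large \<open>\<phi>\<^sup>n\<close> is. There remains
  \<open>g w w = (2 / \<tau>) (\<parallel>w\<parallel>\<^sup>2 - Re (u\<^sup>n\<^sup>-\<^sup>1, w))\<close>, which is nonnegative as soon as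
  \<open>\<parallel>w\<parallel> \<ge> \<parallel>u\<^sup>n\<^sup>-\<^sup>1\<parallel>\<close>. Hence \<open>g\<close> points outwards on a sphere and has a zero inside by
  Brouwer's theorem. This works for every \<open>\<tau>\<close> and \<open>h\<close>.

  The dimension of \<open>V\<^sub>h\<close> depends on the mesh, so the topological argument
  (\<open>zero_of_outward_field\<close>) takes place on sequences of reals, whose first
  \<open>n\<close> coordinates are the unknowns; it comes from Kuhn's combinatorial lemma through
  the theorem of Poincare and Miranda. Orthonormal bases (\<open>orthonormal_basis_exists\<close>)
  turn it into a statement about abstract Galerkin equations (\<open>galerkin_zero\<close>), and
  \<open>crank_nicolson_step\<close> carries out the argument above for abstract symmetric forms.

  For the finite element space three facts are needed: it is a finite-dimensional space
  (\<open>finite_dim_fe\<close>), its members and their gradients are essentially bounded, so that all forms are defined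
  (\<open>fe_Linf\<close>, \<open>fe_grad_Linf\<close>), and the gradient form is definite
  (\<open>zero_of_grad_zero\<close>). For the last point: if the gradient vanishes, the function is constant on each of the finitely many elements, so by
  continuity constant on the connected domain, and it vanishes at the boundary.
\<close>

section \<open>Zeros of vector fields pointing outwards on a sphere\<close>

lemma tendsto_fun_iff:
  "(f \<longlongrightarrow> l) F \<longleftrightarrow> (\<forall>i. ((\<lambda>x. f x i) \<longlongrightarrow> l i) F)"
  for f :: "'x \<Rightarrow> 'i \<Rightarrow> 'b::topological_space"
  using limitin_componentwise[of "\<lambda>_. euclidean" UNIV f l F]
  by (simp add: euclidean_product_topology)

text \<open>
  Points are sequences because the dimension \<open>n\<close> is a variable. Label the points of ever finer grids on the cube
  \<open>[-R, R]\<^sup>n\<close> by the signs of the components of \<open>F\<close>. Kuhn's lemma provides a small cell in which each component is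
  nonpositive at one point and nonnegative at another; by compactness the cells accumulate at a point, where every component
  vanishes by continuity.
\<close>
lemma poincare_miranda:
  fixes F :: "(nat \<Rightarrow> real) \<Rightarrow> nat \<Rightarrow> real"
  assumes R: "R > 0"
    and cont: "\<And>i. i < n \<Longrightarrow> continuous_on UNIV (\<lambda>x. F x i)"
    and lower: "\<And>x i. i < n \<Longrightarrow> x i = - R \<Longrightarrow> F x i \<le> 0"
    and upper: "\<And>x i. i < n \<Longrightarrow> x i = R \<Longrightarrow> F x i \<ge> 0"
  shows "\<exists>x. \<forall>i<n. F x i = 0"
proof -
  \<comment> \<open>The grid point with index vector \<open>k\<close> on the grid with \<open>p\<close> cells per direction, filled up with
    zeros so that all grid points lie in one compact set.\<close>
  define z :: "nat \<Rightarrow> (nat \<Rightarrow> nat) \<Rightarrow> nat \<Rightarrow> real" where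
    "z p k i = (if i < n then - R + 2 * R * real (k i) / real p else 0)" for p k i
  define near where "near p q y \<longleftrightarrow> (\<forall>j. \<bar>y j - z p q j\<bar> \<le> 2 * R / real p)" for p q y
  have ex: "\<exists>q. (\<forall>j<n. q j < Suc m) \<and>
      (\<forall>i<n. \<exists>y y'. near (Suc m) q y \<and> near (Suc m) q y' \<and> F y i \<le> 0 \<and> F y' i \<ge> 0)" for m
  proof -
    define p where "p = Suc m"
    have p: "p > 0" by (simp add: p_def)
    \<comment> \<open>On the faces the label is prescribed, as Kuhn's lemma wants it; the sign conditions on \<open>F\<close>
      make this consistent with the meaning of the labels also where \<open>F\<close> vanishes.\<close>
    define label :: "(nat \<Rightarrow> nat) \<Rightarrow> nat \<Rightarrow> nat" where
      "label k i = (if k i = 0 then 0 else if k i = p then 1 else if F (z p k) i \<le> 0 then 0 else 1)" for k i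
    have label0: "F (z p k) i \<le> 0" if "label k i = 0" "i < n" for k i
    proof (cases "k i = 0")
      case True then show ?thesis using that by (intro lower) (simp_all add: z_def)
    next
      case False then show ?thesis using that by (auto simp: label_def split: if_splits)
    qed
    have label1: "F (z p k) i \<ge> 0" if "label k i \<noteq> 0" "i < n" for k i
    proof (cases "k i = p")
      case True then show ?thesis using that p by (intro upper) (simp_all add: z_def)
    next
      case False then show ?thesis using that by (auto simp: label_def split: if_splits)
    qed
    obtain q where q: "\<forall>i<n. q i < p" and rs: "\<forall>i<n. \<exists>r s. (\<forall>j<n. q j \<le> r j \<and> r j \<le> q j + 1) \<and>
        (\<forall>j<n. q j \<le> s j \<and> s j \<le> q j + 1) \<and> label r i \<noteq> label s i"
      by (rule kuhn_lemma[of p n label]) (use p in \<open>auto simp: label_def\<close>)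
    have nr: "near p q (z p r)" if "\<forall>j<n. q j \<le> r j \<and> r j \<le> q j + 1" for r
      unfolding near_def
    proof
      fix j
      show "\<bar>z p r j - z p q j\<bar> \<le> 2 * R / real p"
      proof (cases "j < n")
        case True
        have "z p r j - z p q j = 2 * R / real p * (real (r j) - real (q j))"
          using True by (simp add: z_def right_diff_distrib diff_divide_distrib)
        moreover have "\<bar>real (r j) - real (q j)\<bar> \<le> 1" using that True by force
        moreover have "2 * R / real p \<ge> 0" using R by simp
        ultimately show ?thesis by (simp only: abs_mult abs_of_nonneg mult_left_le)
      qed (use R p in \<open>simp add: z_def\<close>)
    qed
    show ?thesis unfolding p_def[symmetric]
    proof (intro exI[of _ q] conjI q allI impI)
      fix i assume i: "i < n"
      then obtain r s where r: "\<forall>j<n. q j \<le> r j \<and> r j \<le> q j + 1" and s: "\<forall>j<n. q j \<le> s j \<and> s j \<le> q j + 1"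
        and d: "label r i \<noteq> label s i" using rs by metis
      show "\<exists>y y'. near p q y \<and> near p q y' \<and> F y i \<le> 0 \<and> F y' i \<ge> 0"
      proof (cases "label r i = 0")
        case True then show ?thesis using nr[OF r] nr[OF s] label0[of r i] label1[of s i] d i by metis
      next
        case False
        then have "label s i = 0" using d by (auto simp: label_def split: if_splits)
        then show ?thesis using nr[OF r] nr[OF s] label0[of s i] label1[of r i] False i by metis
      qed
    qed
  qed
  then obtain q where q: "\<And>m j. j < n \<Longrightarrow> q m j < Suc m"
    and qF: "\<And>m i. i < n \<Longrightarrow> \<exists>y y'. near (Suc m) (q m) y \<and> near (Suc m) (q m) y' \<and> F y i \<le> 0 \<and> F y' i \<ge> 0"
    by metis
  then have "\<forall>m i. \<exists>y y'. i < n \<longrightarrow> near (Suc m) (q m) y \<and> near (Suc m) (q m) y' \<and> F y i \<le> 0 \<and> F y' i \<ge> 0"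
    by blast
  then obtain Y Y' where Y: "\<And>m i. i < n \<Longrightarrow> near (Suc m) (q m) (Y m i) \<and> near (Suc m) (q m) (Y' m i)
      \<and> F (Y m i) i \<le> 0 \<and> F (Y' m i) i \<ge> 0" by metis
  define X where "X m = z (Suc m) (q m)" for m
  have Xin: "X m \<in> PiE UNIV (\<lambda>_. {-R..R})" for m
  proof -
    have "- R \<le> X m j \<and> X m j \<le> R" for j
    proof (cases "j < n")
      case True
      have "real (q m j) / real (Suc m) \<le> 1" using q[OF True, of m] by simp
      then have "2 * R * (real (q m j) / real (Suc m)) \<le> 2 * R * 1" using R by (intro mult_left_mono) auto
      then show ?thesis using True R by (simp add: X_def z_def)
    qed (use R in \<open>simp add: X_def z_def\<close>)
    then show ?thesis by auto
  qed
  have "compact (PiE UNIV (\<lambda>_::nat. {-R..R}))"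
    using compactin_PiE[of "\<lambda>_::nat. euclidean::real topology" UNIV "\<lambda>_. {-R..R}"]
    by (simp add: euclidean_product_topology)
  then obtain x \<rho> where \<rho>: "strict_mono (\<rho> :: nat \<Rightarrow> nat)" and lim: "(X \<circ> \<rho>) \<longlonglongrightarrow> x"
    using Xin unfolding compact_def by metis
  have lim_near: "(\<lambda>m. y (\<rho> m)) \<longlonglongrightarrow> x" if y: "\<And>m. near (Suc m) (q m) (y m)" for y
    unfolding tendsto_fun_iff
  proof
    fix j
    have "(\<lambda>m. X (\<rho> m) j) \<longlonglongrightarrow> x j"
      using lim by (simp add: tendsto_fun_iff o_def)
    moreover have "(\<lambda>m. y (\<rho> m) j - X (\<rho> m) j) \<longlonglongrightarrow> 0"
    proof (rule Lim_null_comparison)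
      show "\<forall>\<^sub>F m in sequentially. norm (y (\<rho> m) j - X (\<rho> m) j) \<le> 2 * R / real (Suc (\<rho> m))"
        using y by (auto simp: near_def X_def)
      have "(\<lambda>m. 2 * R / real (Suc m)) \<longlonglongrightarrow> 0"
        by (intro LIMSEQ_Suc lim_const_over_n)
      then show "(\<lambda>m. 2 * R / real (Suc (\<rho> m))) \<longlonglongrightarrow> 0"
        using LIMSEQ_subseq_LIMSEQ[OF _ \<rho>] by (force simp: o_def)
    qed
    ultimately show "(\<lambda>m. y (\<rho> m) j) \<longlonglongrightarrow> x j" by (rule Lim_transform)
  qed
  have "F x i = 0" if i: "i < n" for i
  proof (rule antisym)
    have c: "(\<lambda>m. F (y (\<rho> m)) i) \<longlonglongrightarrow> F x i" if "\<And>m. near (Suc m) (q m) (y m)" for y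
      using continuous_on_tendsto_compose[OF cont[OF i] lim_near[OF that]] by simp
    show "F x i \<le> 0" by (rule LIMSEQ_le_const2[OF c[of "\<lambda>m. Y m i"]]) (use Y i in auto)
    show "F x i \<ge> 0" by (rule LIMSEQ_le_const[OF c[of "\<lambda>m. Y' m i"]]) (use Y i in auto)
  qed
  then show ?thesis by blast
qed

text \<open>
  A zero of \<open>G\<close> is a fixed point of \<open>x \<mapsto> P (x - G x)\<close>, where \<open>P\<close> is the retraction onto the
  ball of radius \<open>R\<close>; the fixed point exists because this map sends the cube into itself.
  Conversely, if \<open>P\<close> moved \<open>x - G x\<close> at a fixed point \<open>x\<close>, then \<open>x\<close> would lie on the sphere
  and \<open>G x\<close> would be a negative multiple of \<open>x\<close>, pointing inwards.
\<close>
lemma zero_of_outward_field: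
  fixes G :: "(nat \<Rightarrow> real) \<Rightarrow> nat \<Rightarrow> real"
  assumes R: "R > 0"
    and cont: "\<And>i. i < n \<Longrightarrow> continuous_on UNIV (\<lambda>x. G x i)"
    and outward: "\<And>x. (\<Sum>i<n. (x i)\<^sup>2) = R\<^sup>2 \<Longrightarrow> (\<Sum>i<n. G x i * x i) \<ge> 0"
  shows "\<exists>x. \<forall>i<n. G x i = 0"
proof -
  define N where "N x = sqrt (\<Sum>i<n. (x i - G x i)\<^sup>2)" for x
  define f where "f x i = R * (x i - G x i) / max R (N x)" for x i
  have comp: "\<bar>x i - G x i\<bar> \<le> N x" if "i < n" for x i
  proof -
    have "(x i - G x i)\<^sup>2 \<le> (\<Sum>i<n. (x i - G x i)\<^sup>2)"
      by (rule member_le_sum) (use that in auto)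
    then show ?thesis by (simp add: N_def real_le_rsqrt)
  qed
  have fR: "\<bar>f x i\<bar> \<le> R" if "i < n" for x i
  proof -
    have "\<bar>f x i\<bar> = R * (\<bar>x i - G x i\<bar> / max R (N x))" using R by (simp add: f_def abs_mult)
    also have "\<dots> \<le> R * 1" using comp[OF that, of x] R by (intro mult_left_mono) (auto simp: divide_simps)
    finally show ?thesis by simp
  qed
  have cN: "continuous_on UNIV N" unfolding N_def using cont by (intro continuous_intros) auto
  have "\<exists>x. \<forall>i<n. x i - f x i = 0"
  proof (rule poincare_miranda[OF R])
    show "continuous_on UNIV (\<lambda>x. x i - f x i)" if "i < n" for i
      unfolding f_def using cont[OF that] cN R by (intro continuous_intros) auto
    show "x i - f x i \<le> 0" if "i < n" "x i = - R" for x i using fR[OF that(1), of x] that by linarith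
    show "x i - f x i \<ge> 0" if "i < n" "x i = R" for x i using fR[OF that(1), of x] that by linarith
  qed
  then obtain x where "\<forall>i<n. x i - f x i = 0" by blast
  then have x: "x i = f x i" if "i < n" for i using that by simp
  have "N x \<le> R"
  proof (rule ccontr)
    assume "\<not> N x \<le> R"
    then have NR: "N x > R" by simp
    then have xi: "x i - G x i = N x / R * x i" if "i < n" for i
      using x[OF that] R by (simp add: f_def field_simps)
    have sq: "(\<Sum>i<n. (x i)\<^sup>2) = R\<^sup>2"
    proof -
      have "(N x)\<^sup>2 = (\<Sum>i<n. (x i - G x i)\<^sup>2)" by (simp add: N_def sum_nonneg)
      also have "\<dots> = (N x / R)\<^sup>2 * (\<Sum>i<n. (x i)\<^sup>2)"
        unfolding sum_distrib_left by (intro sum.cong) (auto simp: xi power_mult_distrib power_divide)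
      finally show ?thesis using NR R by (simp add: power_divide field_simps)
    qed
    have "(\<Sum>i<n. G x i * x i) = (\<Sum>i<n. (1 - N x / R) * (x i)\<^sup>2)"
    proof (intro sum.cong refl)
      fix i assume "i \<in> {..<n}"
      then have "G x i = (1 - N x / R) * x i" using xi[of i] by (simp add: left_diff_distrib)
      then show "G x i * x i = (1 - N x / R) * (x i)\<^sup>2" by (simp add: power2_eq_square)
    qed
    also have "\<dots> = (1 - N x / R) * R\<^sup>2" by (simp only: sq sum_distrib_left[symmetric])
    also have "\<dots> < 0" using NR R by (intro mult_neg_pos) auto
    finally show False using outward[OF sq] by simp
  qed
  then have "G x i = 0" if "i < n" for i using x[OF that] R by (simp add: f_def max_def split: if_splits)
  then show ?thesis by blast
qed

section \<open>Inner products on finite-dimensional subspaces\<close>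

text \<open>
  Linearity is only asked on a subset since forms given by integrals are additive only where the integrands
  are integrable.
\<close>
definition linear_form_on :: "'a::real_vector set \<Rightarrow> ('a \<Rightarrow> real) \<Rightarrow> bool" where
  "linear_form_on V f \<longleftrightarrow>
     (\<forall>x\<in>V. \<forall>y\<in>V. f (x + y) = f x + f y) \<and> (\<forall>c. \<forall>x\<in>V. f (c *\<^sub>R x) = c * f x)"

text \<open>
  Symmetry on \<open>V\<close> carries linearity from one slot to the other only if \<open>V\<close> is closed under sums
  and multiples; therefore both slots are mentioned.
\<close>
definition inner_product_on :: "'a::real_vector set \<Rightarrow> ('a \<Rightarrow> 'a \<Rightarrow> real) \<Rightarrow> bool" where
  "inner_product_on V B \<longleftrightarrow>
     (\<forall>y\<in>V. linear_form_on V (B y) \<and> linear_form_on V (\<lambda>x. B x y)) \<and>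
     (\<forall>x\<in>V. \<forall>y\<in>V. B x y = B y x) \<and>
     (\<forall>x\<in>V. x \<noteq> 0 \<longrightarrow> B x x > 0)"

definition finite_dim_subspace :: "'a::real_vector set \<Rightarrow> bool" where
  "finite_dim_subspace V \<longleftrightarrow> subspace V \<and> (\<exists>S. finite S \<and> V \<subseteq> span S)"

definition orthonormal_basis_on ::
    "'a::real_vector set \<Rightarrow> ('a \<Rightarrow> 'a \<Rightarrow> real) \<Rightarrow> nat \<Rightarrow> (nat \<Rightarrow> 'a) \<Rightarrow> bool" where
  "orthonormal_basis_on V B m e \<longleftrightarrow>
     (\<forall>i<m. e i \<in> V) \<and> (\<forall>i<m. \<forall>j<m. B (e i) (e j) = of_bool (i = j)) \<and>
     (\<forall>v\<in>V. v = (\<Sum>i<m. B v (e i) *\<^sub>R e i))"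

lemma linear_form_on_add: "linear_form_on V f \<Longrightarrow> x \<in> V \<Longrightarrow> y \<in> V \<Longrightarrow> f (x + y) = f x + f y"
  and linear_form_on_scale: "linear_form_on V f \<Longrightarrow> x \<in> V \<Longrightarrow> f (c *\<^sub>R x) = c * f x"
  by (auto simp: linear_form_on_def)

lemma linear_form_on_diff:
  "linear_form_on V f \<Longrightarrow> subspace V \<Longrightarrow> x \<in> V \<Longrightarrow> y \<in> V \<Longrightarrow> f (x - y) = f x - f y"
  using linear_form_on_add[of V f "x - y" y] subspace_diff[of V x y] by simp

lemma linear_form_on_sum:
  assumes f: "linear_form_on V f" and V: "subspace V" and I: "\<And>i. i \<in> I \<Longrightarrow> e i \<in> V"
  shows "f (\<Sum>i\<in>I. c i *\<^sub>R e i) = (\<Sum>i\<in>I. c i * f (e i))"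
  using I
proof (induction I rule: infinite_finite_induct)
  case (insert i I)
  have "f (c i *\<^sub>R e i + (\<Sum>i\<in>I. c i *\<^sub>R e i)) = f (c i *\<^sub>R e i) + f (\<Sum>i\<in>I. c i *\<^sub>R e i)"
    by (intro linear_form_on_add[OF f] subspace_sum[OF V] subspace_mul[OF V]) (use insert in auto)
  then show ?case using insert linear_form_on_scale[OF f] by simp
next
  case empty
  then show ?case using linear_form_on_scale[OF f subspace_0[OF V], of 0] by simp
next
  case (infinite I)
  then show ?case using linear_form_on_scale[OF f subspace_0[OF V], of 0] by simp
qed

lemma inner_product_on_linear:
  "inner_product_on V B \<Longrightarrow> y \<in> V \<Longrightarrow> linear_form_on V (\<lambda>x. B x y)"
  "inner_product_on V B \<Longrightarrow> x \<in> V \<Longrightarrow> linear_form_on V (B x)"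
  "inner_product_on V B \<Longrightarrow> x \<in> V \<Longrightarrow> y \<in> V \<Longrightarrow> B x y = B y x"
  by (simp_all add: inner_product_on_def)

lemma inner_product_on_nonneg:
  assumes "inner_product_on V B" "x \<in> V"
  shows "B x x \<ge> 0"
proof (cases "x = 0")
  case True
  then show ?thesis using linear_form_on_scale[OF inner_product_on_linear(1)[OF assms] assms(2), of 0] by simp
next
  case False
  then have "B x x > 0" using assms by (simp add: inner_product_on_def)
  then show ?thesis by simp
qed

lemma inner_product_on_subset:
  "inner_product_on V B \<Longrightarrow> W \<subseteq> V \<Longrightarrow> inner_product_on W B"
  by (simp add: inner_product_on_def linear_form_on_def subset_iff)

lemma orthonormal_basis_onD:
  assumes "orthonormal_basis_on V B m e"
  shows "\<And>i. i < m \<Longrightarrow> e i \<in> V" "\<And>v. v \<in> V \<Longrightarrow> v = (\<Sum>i<m. B v (e i) *\<^sub>R e i)"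
    "\<And>i j. i < m \<Longrightarrow> j < m \<Longrightarrow> B (e i) (e j) = of_bool (i = j)"
  using assms by (simp_all add: orthonormal_basis_on_def)

text \<open>
  Gram-Schmidt, but on a space that is only known to sit inside the span of a finite set \<open>S\<close>
  whose elements need not belong to it. Induction on \<open>S\<close> splits off one dimension at a time:
  the part of \<open>V\<close> in the span of the smaller set has codimension at most one, since of any
  two vectors of \<open>V\<close> some nontrivial combination lies in it.
\<close>
lemma orthonormal_basis_exists:
  assumes "finite_dim_subspace V" "inner_product_on V B"
  obtains m e where "orthonormal_basis_on V B m e"
proof -
  have "\<exists>m e. orthonormal_basis_on V B m e"
    if "finite S" "subspace V" "V \<subseteq> span S" "inner_product_on V B" for S V
    using that
  proof (induction S arbitrary: V rule: finite_induct)
    case empty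
    then have "V = {0}" using subspace_0 by auto
    then show ?case by (intro exI[of _ 0]) (auto simp: orthonormal_basis_on_def)
  next
    case (insert a S V)
    note V = insert.prems(1) and B = insert.prems(3)
    define U where "U = V \<inter> span S"
    have U: "subspace U" using V by (simp add: U_def subspace_inter)
    have "\<exists>m e. orthonormal_basis_on U B m e"
      by (rule insert.IH[OF U]) (auto simp: U_def intro: inner_product_on_subset[OF B])
    then obtain m e where onb: "orthonormal_basis_on U B m e" by blast
    note eU = orthonormal_basis_onD(1)[OF onb] and rep = orthonormal_basis_onD(2)[OF onb]
      and on = orthonormal_basis_onD(3)[OF onb]
    have eV: "e i \<in> V" if "i < m" for i using eU[OF that] by (simp add: U_def)
    show ?case
    proof (cases "V \<subseteq> U")
      case True
      then have "V = U" by (auto simp: U_def)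
      then show ?thesis using onb by blast
    next
      case False
      then obtain v where v: "v \<in> V" "v \<notin> span S" by (auto simp: U_def)
      define w where "w = v - (\<Sum>i<m. B v (e i) *\<^sub>R e i)"
      have sumU: "(\<Sum>i<m. c i *\<^sub>R e i) \<in> U" for c using eU U by (auto intro!: subspace_sum subspace_mul)
      have sumV: "(\<Sum>i<m. c i *\<^sub>R e i) \<in> V" for c using sumU by (auto simp: U_def)
      have w: "w \<in> V" "w \<notin> span S"
      proof -
        show "w \<in> V" unfolding w_def using v V sumV by (intro subspace_diff) auto
        show "w \<notin> span S"
        proof
          assume "w \<in> span S"
          then have "w + (\<Sum>i<m. B v (e i) *\<^sub>R e i) \<in> span S"
            using sumU by (intro span_add) (auto simp: U_def)
          then show False using v by (simp add: w_def)
        qed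
      qed
      have we: "B w (e j) = 0" if "j < m" for j
      proof -
        note lin = inner_product_on_linear(1)[OF B eV[OF that]]
        have "B w (e j) = B v (e j) - B (\<Sum>i<m. B v (e i) *\<^sub>R e i) (e j)"
          unfolding w_def by (rule linear_form_on_diff[OF lin V v(1) sumV])
        also have "B (\<Sum>i<m. B v (e i) *\<^sub>R e i) (e j) = (\<Sum>i<m. B v (e i) * B (e i) (e j))"
          by (rule linear_form_on_sum[OF lin V]) (use eV in auto)
        also have "(\<Sum>i<m. B v (e i) * B (e i) (e j)) = (\<Sum>i<m. if i = j then B v (e i) else 0)"
          by (intro sum.cong) (auto simp: on that)
        finally show ?thesis using that by simp
      qed
      have "w \<noteq> 0" using w span_zero by blast
      then have Bw: "B w w > 0" using B w by (auto simp: inner_product_on_def)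
      define s where "s = sqrt (B w w)"
      have s: "s > 0" "s * s = B w w" using Bw by (auto simp: s_def)
      define e' where "e' i = (if i < m then e i else (1 / s) *\<^sub>R w)" for i
      have last: "(1 / s) *\<^sub>R w \<in> V" using V w by (simp add: subspace_mul)
      have e'V: "e' i \<in> V" for i using eV last by (simp add: e'_def)
      have lin1: "B ((1 / s) *\<^sub>R w) y = B w y / s" if "y \<in> V" for y
        using linear_form_on_scale[OF inner_product_on_linear(1)[OF B that] w(1)] by simp
      have lin2: "B y ((1 / s) *\<^sub>R w) = B w y / s" if "y \<in> V" for y
        using linear_form_on_scale[OF inner_product_on_linear(2)[OF B that] w(1)]
          inner_product_on_linear(3)[OF B that w(1)] by simp
      have "B (e' i) (e' j) = of_bool (i = j)" if "i < Suc m" "j < Suc m" for i j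
      proof -
        have "B ((1 / s) *\<^sub>R w) ((1 / s) *\<^sub>R w) = 1"
          using lin1[OF last] lin2[OF w(1)] s Bw by (simp add: field_simps)
        then show ?thesis using that by (auto simp: e'_def on lin1 lin2 eV we less_Suc_eq)
      qed
      moreover have "y = (\<Sum>i<Suc m. B y (e' i) *\<^sub>R e' i)" if y: "y \<in> V" for y
      proof -
        obtain k where k: "y - k *\<^sub>R a \<in> span S"
          using insert.prems(2) y span_breakdown_eq[of y a S] by blast
        obtain l where l: "w - l *\<^sub>R a \<in> span S"
          using insert.prems(2) w span_breakdown_eq[of w a S] by blast
        have "l \<noteq> 0" using l w by auto
        define t where "t = k / l"
        have "(y - k *\<^sub>R a) - t *\<^sub>R (w - l *\<^sub>R a) \<in> span S"
          by (rule span_diff[OF k span_scale[OF l]])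
        moreover have "(y - k *\<^sub>R a) - t *\<^sub>R (w - l *\<^sub>R a) = y - t *\<^sub>R w"
          using \<open>l \<noteq> 0\<close> by (simp add: t_def algebra_simps)
        ultimately have u: "y - t *\<^sub>R w \<in> U" using y w V by (simp add: U_def subspace_diff subspace_mul)
        define u where "u = y - t *\<^sub>R w"
        have uU: "u \<in> U" and uV: "u \<in> V" using u by (auto simp: u_def U_def)
        have yu: "y = u + t *\<^sub>R w" by (simp add: u_def)
        have By: "B y z = B u z + t * B w z" if "z \<in> V" for z
          unfolding yu linear_form_on_add[OF inner_product_on_linear(1)[OF B that] uV subspace_mul[OF V w(1)]]
          by (simp add: linear_form_on_scale[OF inner_product_on_linear(1)[OF B that] w(1)])
        have "B u w = 0"
        proof -
          have "B u w = B (\<Sum>i<m. B u (e i) *\<^sub>R e i) w" using rep[OF uU] by simp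
          also have "\<dots> = (\<Sum>i<m. B u (e i) * B (e i) w)"
            by (rule linear_form_on_sum[OF inner_product_on_linear(1)[OF B w(1)] V]) (use eV in auto)
          also have "\<dots> = 0" using we inner_product_on_linear(3)[OF B _ w(1)] eV by simp
          finally show ?thesis .
        qed
        then have "B y w = t * (s * s)" using By[OF w(1)] s by simp
        then have "B y ((1/s) *\<^sub>R w) = t * s"
          using lin2[OF y] inner_product_on_linear(3)[OF B y w(1)] s(1) by simp
        moreover have "(\<Sum>i<m. B y (e i) *\<^sub>R e i) = (\<Sum>i<m. B u (e i) *\<^sub>R e i)"
          by (intro sum.cong refl) (simp add: By eV we)
        then have "(\<Sum>i<m. B y (e i) *\<^sub>R e i) = u" using rep[OF uU] by simp
        ultimately show ?thesis using yu s(1) by (simp add: e'_def)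
      qed
      ultimately have "orthonormal_basis_on V B (Suc m) e'"
        using e'V unfolding orthonormal_basis_on_def by blast
      then show ?thesis by blast
    qed
  qed
  then have "\<exists>m e. orthonormal_basis_on V B m e"
    using assms unfolding finite_dim_subspace_def by blast
  then show thesis using that by blast
qed

text \<open>
  The explicit formula for the representing vector also shows how it depends on \<open>f\<close>, which
  makes the solution of a linear problem continuous in its data.
\<close>
lemma riesz_formula:
  assumes V: "subspace V" and B: "inner_product_on V B" and e: "orthonormal_basis_on V B m e"
    and f: "linear_form_on V f" and v: "v \<in> V"
  shows "B (\<Sum>i<m. f (e i) *\<^sub>R e i) v = f v"
proof -
  have "B (\<Sum>i<m. f (e i) *\<^sub>R e i) v = (\<Sum>i<m. f (e i) * B (e i) v)"
    by (rule linear_form_on_sum[OF inner_product_on_linear(1)[OF B v] V])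
      (use orthonormal_basis_onD(1)[OF e] in auto)
  also have "\<dots> = (\<Sum>i<m. B v (e i) * f (e i))"
    using inner_product_on_linear(3)[OF B _ v] orthonormal_basis_onD(1)[OF e] by (auto simp: mult.commute)
  also have "\<dots> = f (\<Sum>i<m. B v (e i) *\<^sub>R e i)"
    by (rule linear_form_on_sum[OF f V, symmetric]) (use orthonormal_basis_onD(1)[OF e] in auto)
  finally show ?thesis using orthonormal_basis_onD(2)[OF e v] by simp
qed

lemma riesz_representation:
  assumes V: "finite_dim_subspace V" and B: "inner_product_on V B" and f: "linear_form_on V f"
  shows "\<exists>!z. z \<in> V \<and> (\<forall>v\<in>V. B z v = f v)"
proof -
  have sV: "subspace V" using V by (simp add: finite_dim_subspace_def)
  obtain m e where e: "orthonormal_basis_on V B m e" by (rule orthonormal_basis_exists[OF V B])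
  show ?thesis
  proof (rule ex1I)
    show "(\<Sum>i<m. f (e i) *\<^sub>R e i) \<in> V \<and> (\<forall>v\<in>V. B (\<Sum>i<m. f (e i) *\<^sub>R e i) v = f v)"
      using riesz_formula[OF sV B e f] orthonormal_basis_onD(1)[OF e] sV
      by (auto intro!: subspace_sum subspace_mul)
  next
    fix z assume z: "z \<in> V \<and> (\<forall>v\<in>V. B z v = f v)"
    then have "z = (\<Sum>i<m. B z (e i) *\<^sub>R e i)"
      using orthonormal_basis_onD(2)[OF e] by blast
    also have "\<dots> = (\<Sum>i<m. f (e i) *\<^sub>R e i)"
      using z orthonormal_basis_onD(1)[OF e] by (intro sum.cong) auto
    finally show "z = (\<Sum>i<m. f (e i) *\<^sub>R e i)" .
  qed
qed

lemma finite_dim_subspace_Times: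
  assumes "finite_dim_subspace V" "finite_dim_subspace W"
  shows "finite_dim_subspace (V \<times> W)"
proof -
  obtain S R where S: "finite S" "V \<subseteq> span S" and R: "finite R" "W \<subseteq> span R"
    using assms by (auto simp: finite_dim_subspace_def)
  have l1: "linear (\<lambda>x. (x, 0))" and l2: "linear (\<lambda>x. (0, x))" by (auto intro!: linearI)
  have "V \<times> W \<subseteq> span ((\<lambda>x. (x, 0)) ` S \<union> (\<lambda>x. (0, x)) ` R)"
  proof clarify
    fix v w assume "v \<in> V" "w \<in> W"
    then have "(v, 0) \<in> span ((\<lambda>x. (x, 0)) ` S)" "(0, w) \<in> span ((\<lambda>x. (0, x)) ` R)"
      using S R by (auto simp: linear_span_image[OF l1] linear_span_image[OF l2])
    then have "(v, 0) + (0, w) \<in> span ((\<lambda>x. (x, 0)) ` S \<union> (\<lambda>x. (0, x)) ` R)"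
      using span_mono[OF Un_upper1] span_mono[OF Un_upper2] by (intro span_add) blast+
    then show "(v, w) \<in> span ((\<lambda>x. (x, 0)) ` S \<union> (\<lambda>x. (0, x)) ` R)" by simp
  qed
  moreover have "finite ((\<lambda>x. (x, 0)) ` S \<union> (\<lambda>x. (0, x)) ` R)" using S R by simp
  moreover have "subspace (V \<times> W)" using assms by (simp add: finite_dim_subspace_def subspace_Times)
  ultimately show ?thesis unfolding finite_dim_subspace_def by blast
qed

section \<open>Nonlinear Galerkin equations and the midpoint step\<close>

text \<open>
  The ambient vector space carries no topology, so continuity on a finite-dimensional subspace
  means continuity in the coefficients of linear combinations. Testing all finite families
  avoids fixing a basis.
\<close>
definition continuous_in_coords :: "'a::real_vector set \<Rightarrow> ('a \<Rightarrow> real) \<Rightarrow> bool" where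
  "continuous_in_coords W f \<longleftrightarrow>
     (\<forall>n e. (\<forall>i<n. e i \<in> W) \<longrightarrow> continuous_on UNIV (\<lambda>x :: nat \<Rightarrow> real. f (\<Sum>i<n. x i *\<^sub>R e i)))"

lemma continuous_in_coords_const: "continuous_in_coords W (\<lambda>w. c)"
  by (simp add: continuous_in_coords_def)

lemma continuous_in_coords_add:
  "continuous_in_coords W f \<Longrightarrow> continuous_in_coords W g \<Longrightarrow> continuous_in_coords W (\<lambda>w. f w + g w)"
  by (simp add: continuous_in_coords_def continuous_on_add)

lemma continuous_in_coords_diff:
  "continuous_in_coords W f \<Longrightarrow> continuous_in_coords W g \<Longrightarrow> continuous_in_coords W (\<lambda>w. f w - g w)"
  by (simp add: continuous_in_coords_def continuous_on_diff)

lemma continuous_in_coords_mult: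
  "continuous_in_coords W f \<Longrightarrow> continuous_in_coords W g \<Longrightarrow> continuous_in_coords W (\<lambda>w. f w * g w)"
  by (simp add: continuous_in_coords_def continuous_on_mult)

lemma continuous_in_coords_sum:
  "(\<And>i. i \<in> I \<Longrightarrow> continuous_in_coords W (f i)) \<Longrightarrow> continuous_in_coords W (\<lambda>w. \<Sum>i\<in>I. f i w)"
  by (auto simp: continuous_in_coords_def intro!: continuous_on_sum)

lemma continuous_in_coords_cong:
  assumes "subspace W" "\<And>w. w \<in> W \<Longrightarrow> f w = g w" "continuous_in_coords W f"
  shows "continuous_in_coords W g"
  unfolding continuous_in_coords_def
proof (intro allI impI)
  fix n :: nat and e :: "nat \<Rightarrow> 'a"
  assume e: "\<forall>i<n. e i \<in> W"
  then have "(\<Sum>i<n. x i *\<^sub>R e i) \<in> W" for x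
    using assms(1) by (intro subspace_sum subspace_mul) auto
  then show "continuous_on UNIV (\<lambda>x :: nat \<Rightarrow> real. g (\<Sum>i<n. x i *\<^sub>R e i))"
    using assms(2,3) e by (simp add: continuous_in_coords_def flip: assms(2))
qed

lemma continuous_in_coords_linear:
  assumes W: "subspace W" and f: "linear_form_on W f"
  shows "continuous_in_coords W f"
  unfolding continuous_in_coords_def
proof (intro allI impI)
  fix n :: nat and e :: "nat \<Rightarrow> 'a"
  assume e: "\<forall>i<n. e i \<in> W"
  have "f (\<Sum>i<n. x i *\<^sub>R e i) = (\<Sum>i<n. x i * f (e i))" for x
    by (rule linear_form_on_sum[OF f W]) (use e in auto)
  then show "continuous_on UNIV (\<lambda>x :: nat \<Rightarrow> real. f (\<Sum>i<n. x i *\<^sub>R e i))"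
    by (auto intro!: continuous_intros)
qed

text \<open>
  In orthonormal coordinates the field \<open>i \<mapsto> g w (e i)\<close> has the scalar product \<open>g w w\<close> with
  the coordinates of \<open>w\<close>, and the spheres of \<open>B\<close> are Euclidean spheres; so this is
  \<open>zero_of_outward_field\<close> without coordinates.
\<close>
lemma galerkin_zero:
  assumes W: "finite_dim_subspace W" and B: "inner_product_on W B"
    and lin: "\<And>w. w \<in> W \<Longrightarrow> linear_form_on W (g w)"
    and cont: "\<And>v. v \<in> W \<Longrightarrow> continuous_in_coords W (\<lambda>w. g w v)"
    and R: "R > 0" and outward: "\<And>w. w \<in> W \<Longrightarrow> B w w = R\<^sup>2 \<Longrightarrow> g w w \<ge> 0"
  shows "\<exists>w\<in>W. \<forall>v\<in>W. g w v = 0"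
proof -
  have sW: "subspace W" using W by (simp add: finite_dim_subspace_def)
  obtain m e where onb: "orthonormal_basis_on W B m e" by (rule orthonormal_basis_exists[OF W B])
  note eW = orthonormal_basis_onD(1)[OF onb] and rep = orthonormal_basis_onD(2)[OF onb]
    and on = orthonormal_basis_onD(3)[OF onb]
  define w where "w x = (\<Sum>i<m. x i *\<^sub>R e i)" for x
  have wW: "w x \<in> W" for x unfolding w_def using sW eW by (intro subspace_sum subspace_mul) auto
  have gsum: "g (w y) (w x) = (\<Sum>i<m. x i * g (w y) (e i))" for x y
    unfolding w_def[of x] by (rule linear_form_on_sum[OF lin[OF wW] sW]) (use eW in auto)
  have wi: "B (w x) (e i) = x i" if "i < m" for x i
  proof -
    have "B (w x) (e i) = (\<Sum>j<m. x j * B (e j) (e i))"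
      unfolding w_def
      by (rule linear_form_on_sum[OF inner_product_on_linear(1)[OF B eW[OF that]] sW]) (use eW in auto)
    also have "\<dots> = (\<Sum>j<m. if j = i then x j else 0)"
      by (intro sum.cong) (auto simp: on that)
    finally show ?thesis using that by simp
  qed
  have Bw: "B (w x) (w x) = (\<Sum>i<m. (x i)\<^sup>2)" for x
  proof -
    have "B (w x) (w x) = (\<Sum>i<m. x i * B (w x) (e i))"
      unfolding w_def[of x]
      by (rule linear_form_on_sum[OF inner_product_on_linear(2)[OF B] sW]) (use eW wW[of x] in \<open>auto simp: w_def\<close>)
    then show ?thesis by (simp add: wi power2_eq_square)
  qed
  have "\<exists>x. \<forall>i<m. g (w x) (e i) = 0"
  proof (rule zero_of_outward_field[OF R])
    show "continuous_on UNIV (\<lambda>x. g (w x) (e i))" if "i < m" for i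
      using cont[OF eW[OF that]] eW unfolding continuous_in_coords_def w_def by blast
    show "(\<Sum>i<m. g (w x) (e i) * x i) \<ge> 0" if "(\<Sum>i<m. (x i)\<^sup>2) = R\<^sup>2" for x
      using outward[OF wW, of x] that by (simp add: Bw gsum mult.commute)
  qed
  then obtain x where x: "\<forall>i<m. g (w x) (e i) = 0" by blast
  have "g (w x) v = 0" if "v \<in> W" for v
  proof -
    have "v = w (\<lambda>i. B v (e i))" using rep[OF that] by (simp add: w_def)
    then have "g (w x) v = g (w x) (w (\<lambda>i. B v (e i)))" by simp
    also have "\<dots> = 0" unfolding gsum using x by simp
    finally show ?thesis .
  qed
  then show ?thesis using wW by blast
qed

text \<open>
  Weak continuity, which in a finite-dimensional target is the same as continuity.
\<close>
definition continuous_map_in_coords :: "'a::real_vector set \<Rightarrow> 'b::real_vector set \<Rightarrow> ('a \<Rightarrow> 'b) \<Rightarrow> bool" where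
  "continuous_map_in_coords W V P \<longleftrightarrow>
     (\<forall>w\<in>W. P w \<in> V) \<and> (\<forall>f. linear_form_on V f \<longrightarrow> continuous_in_coords W (\<lambda>w. f (P w)))"

lemma continuous_map_in_coords_const: "v \<in> V \<Longrightarrow> continuous_map_in_coords W V (\<lambda>w. v)"
  by (simp add: continuous_map_in_coords_def continuous_in_coords_const)

lemma continuous_map_in_coords_lincomb:
  assumes W: "subspace W" and V: "subspace V"
    and c: "\<And>i. i \<in> I \<Longrightarrow> continuous_in_coords W (c i)"
    and P: "\<And>i. i \<in> I \<Longrightarrow> continuous_map_in_coords W V (P i)"
  shows "continuous_map_in_coords W V (\<lambda>w. \<Sum>i\<in>I. c i w *\<^sub>R P i w)"
  unfolding continuous_map_in_coords_def
proof (intro conjI ballI allI impI)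
  have PV: "P i w \<in> V" if "i \<in> I" "w \<in> W" for i w
    using P that by (simp add: continuous_map_in_coords_def)
  show "(\<Sum>i\<in>I. c i w *\<^sub>R P i w) \<in> V" if "w \<in> W" for w
    using PV[OF _ that] by (intro subspace_sum[OF V] subspace_mul[OF V])
  fix f assume f: "linear_form_on V f"
  show "continuous_in_coords W (\<lambda>w. f (\<Sum>i\<in>I. c i w *\<^sub>R P i w))"
  proof (rule continuous_in_coords_cong[OF W])
    show "(\<Sum>i\<in>I. c i w * f (P i w)) = f (\<Sum>i\<in>I. c i w *\<^sub>R P i w)" if "w \<in> W" for w
      by (rule linear_form_on_sum[OF f V, symmetric]) (use PV that in auto)
    show "continuous_in_coords W (\<lambda>w. \<Sum>i\<in>I. c i w * f (P i w))"
      using P f c by (intro continuous_in_coords_sum continuous_in_coords_mult)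
        (auto simp: continuous_map_in_coords_def)
  qed
qed

lemma continuous_map_in_coords_comb2:
  assumes W: "subspace W" and V: "subspace V"
    and P: "continuous_map_in_coords W V P" and Q: "continuous_map_in_coords W V Q"
  shows "continuous_map_in_coords W V (\<lambda>w. a *\<^sub>R P w + b *\<^sub>R Q w)"
proof -
  have "continuous_map_in_coords W V
      (\<lambda>w. \<Sum>i\<in>{True, False}. (if i then a else b) *\<^sub>R (if i then P else Q) w)"
    by (rule continuous_map_in_coords_lincomb[OF W V,
          where c = "\<lambda>i w. if i then a else b" and P = "\<lambda>i. if i then P else Q"]) (use P Q in \<open>simp_all add: continuous_in_coords_const\<close>)
  then show ?thesis by simp
qed

text \<open>
  Weak continuity of both arguments suffices: expanding the first one in an orthonormal basis
  turns the form into a finite sum of products of continuous functions. The inner product \<open>M\<close>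
  is only a means to have such a basis.
\<close>
lemma continuous_in_coords_bilinear:
  assumes W: "subspace W" and V: "finite_dim_subspace V" and M: "inner_product_on V M"
    and lin1: "\<And>y. y \<in> V \<Longrightarrow> linear_form_on V (\<lambda>x. B x y)"
    and lin2: "\<And>x. x \<in> V \<Longrightarrow> linear_form_on V (B x)"
    and P: "continuous_map_in_coords W V P" and Q: "continuous_map_in_coords W V Q"
  shows "continuous_in_coords W (\<lambda>w. B (P w) (Q w))"
proof -
  have sV: "subspace V" using V by (simp add: finite_dim_subspace_def)
  obtain m e where onb: "orthonormal_basis_on V M m e" by (rule orthonormal_basis_exists[OF V M])
  note eV = orthonormal_basis_onD(1)[OF onb] and rep = orthonormal_basis_onD(2)[OF onb]
  show ?thesis
  proof (rule continuous_in_coords_cong[OF W])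
    fix w assume "w \<in> W"
    then have PV: "P w \<in> V" and QV: "Q w \<in> V" using P Q by (auto simp: continuous_map_in_coords_def)
    have "B (P w) (Q w) = B (\<Sum>i<m. M (P w) (e i) *\<^sub>R e i) (Q w)" using rep[OF PV] by simp
    also have "\<dots> = (\<Sum>i<m. M (P w) (e i) * B (e i) (Q w))"
      by (rule linear_form_on_sum[OF lin1[OF QV] sV]) (use eV in auto)
    finally show "(\<Sum>i<m. M (P w) (e i) * B (e i) (Q w)) = B (P w) (Q w)" by simp
  next
    show "continuous_in_coords W (\<lambda>w. \<Sum>i<m. M (P w) (e i) * B (e i) (Q w))"
    proof (intro continuous_in_coords_sum continuous_in_coords_mult)
      fix i assume "i \<in> {..<m}"
      then have i: "e i \<in> V" using eV by simp
      show "continuous_in_coords W (\<lambda>w. M (P w) (e i))"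
        using P inner_product_on_linear(1)[OF M i] unfolding continuous_map_in_coords_def by blast
      show "continuous_in_coords W (\<lambda>w. B (e i) (Q w))"
        using Q lin2[OF i] unfolding continuous_map_in_coords_def by blast
    qed
  qed
qed

definition symmetric_trilinear_on :: "'a::real_vector set \<Rightarrow> ('a \<Rightarrow> 'a \<Rightarrow> 'a \<Rightarrow> real) \<Rightarrow> bool" where
  "symmetric_trilinear_on V T \<longleftrightarrow>
     (\<forall>x\<in>V. \<forall>y\<in>V. linear_form_on V (T x y) \<and> linear_form_on V (\<lambda>z. T x z y) \<and> linear_form_on V (\<lambda>z. T z x y)) \<and>
     (\<forall>x\<in>V. \<forall>y\<in>V. \<forall>z\<in>V. T x y z = T x z y)"

text \<open>
  One step of the scheme, with \<open>\<mu> = 1 / \<tau>\<close>, old values \<open>a0 + \<i> b0\<close> and \<open>\<phi>0\<close>, new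
  values \<open>a + \<i> b\<close> and \<open>\<phi>\<close>. \<open>M\<close> stands for the \<open>L\<^sup>2\<close> product, \<open>A\<close> for the
  gradient form, \<open>S\<close> for the form of the equation for the potential, \<open>T f g h\<close> for the integral of \<open>f g h\<close>. The first two equations
  are the imaginary and the negative real part of the Schroedinger equation tested with real functions.
\<close>
lemma crank_nicolson_step:
  assumes V: "finite_dim_subspace V"
    and M: "inner_product_on V M" and A: "inner_product_on V A" and S: "inner_product_on V S"
    and T: "symmetric_trilinear_on V T"
    and \<mu>: "\<mu> > 0" and a0: "a0 \<in> V" and b0: "b0 \<in> V" and \<phi>0: "\<phi>0 \<in> V"
  shows "\<exists>a\<in>V. \<exists>b\<in>V. \<exists>\<phi>\<in>V.
     (\<forall>c\<in>V. M (\<mu> *\<^sub>R (a - a0)) c - A ((1/2) *\<^sub>R (b + b0)) c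
        - T ((1/2) *\<^sub>R (\<phi> + \<phi>0)) ((1/2) *\<^sub>R (b + b0)) c = 0) \<and>
     (\<forall>c\<in>V. M (\<mu> *\<^sub>R (b - b0)) c + A ((1/2) *\<^sub>R (a + a0)) c
        + T ((1/2) *\<^sub>R (\<phi> + \<phi>0)) ((1/2) *\<^sub>R (a + a0)) c = 0) \<and>
     (\<forall>c\<in>V. S \<phi> c = T a a c + T b b c)"
proof -
  have sV: "subspace V" using V by (simp add: finite_dim_subspace_def)
  have T3: "linear_form_on V (T x y)" and T2: "linear_form_on V (\<lambda>z. T x z y)"
    and T1: "linear_form_on V (\<lambda>z. T z x y)" and Tsym: "z \<in> V \<Longrightarrow> T x y z = T x z y"
    if "x \<in> V" "y \<in> V" for x y z
    using T that by (auto simp: symmetric_trilinear_on_def)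
  define W where "W = V \<times> V"
  have W: "finite_dim_subspace W" unfolding W_def by (rule finite_dim_subspace_Times[OF V V])
  have sW: "subspace W" using W by (simp add: finite_dim_subspace_def)
  obtain m f where onb: "orthonormal_basis_on V S m f" by (rule orthonormal_basis_exists[OF V S])
  note fV = orthonormal_basis_onD(1)[OF onb]
  \<comment> \<open>From here on the unknown is the pair \<open>w\<close> of real and imaginary part of the midpoint value:
    \<open>upd\<close> recovers the new value from it, and \<open>\<Phi> w\<close> is the new potential,
    obtained from its source term \<open>s w\<close> by the Riesz formula.\<close>
  define upd where "upd a0 p = 2 *\<^sub>R p + (-1) *\<^sub>R a0" for a0 p :: 'a
  define s where "s w c = T (upd a0 (fst w)) (upd a0 (fst w)) c + T (upd b0 (snd w)) (upd b0 (snd w)) c" for w c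
  define \<Phi> where "\<Phi> w = (\<Sum>i<m. s w (f i) *\<^sub>R f i)" for w
  define mid where "mid w = (1/2) *\<^sub>R \<Phi> w + (1/2) *\<^sub>R \<phi>0" for w
  define g where "g w v =
      (2 * \<mu> * M (fst w + (-1) *\<^sub>R a0) (fst v) - A (snd w) (fst v) - T (mid w) (snd w) (fst v))
      + (2 * \<mu> * M (snd w + (-1) *\<^sub>R b0) (snd v) + A (fst w) (snd v) + T (mid w) (fst w) (snd v))" for w v
  define B where "B w v = M (fst w) (fst v) + M (snd w) (snd v)" for w v
  have updV: "upd x p \<in> V" if "x \<in> V" "p \<in> V" for x p
    unfolding upd_def using sV that by (intro subspace_add subspace_mul) auto
  have minusV: "p + (-1) *\<^sub>R x \<in> V" if "x \<in> V" "p \<in> V" for x p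
    using sV that by (intro subspace_add subspace_mul) auto
  have \<Phi>V: "\<Phi> w \<in> V" for w
    unfolding \<Phi>_def using sV fV by (intro subspace_sum subspace_mul) auto
  have midV: "mid w \<in> V" for w unfolding mid_def using sV \<Phi>V \<phi>0 by (intro subspace_add subspace_mul) auto
  have slin: "linear_form_on V (s w)" if "w \<in> W" for w
    using T3[OF updV updV] that a0 b0 unfolding W_def s_def linear_form_on_def
    by (auto simp: algebra_simps)
  have Bip: "inner_product_on W B"
    unfolding inner_product_on_def
  proof (intro conjI ballI impI)
    fix w assume w: "w \<in> W"
    then have w1: "fst w \<in> V" and w2: "snd w \<in> V" by (auto simp: W_def)
    show "linear_form_on W (B w)" "linear_form_on W (\<lambda>v. B v w)"
      using inner_product_on_linear[OF M w1] inner_product_on_linear[OF M w2]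
      by (auto simp: linear_form_on_def B_def W_def algebra_simps)
    show "B w v = B v w" if "v \<in> W" for v
      using inner_product_on_linear(3)[OF M] w1 w2 that by (auto simp: B_def W_def)
    show "B w w > 0" if "w \<noteq> 0"
    proof (cases "fst w = 0")
      case True
      then have "snd w \<noteq> 0" using that by (auto simp: prod_eq_iff)
      then show ?thesis using M w1 w2 inner_product_on_nonneg[OF M w1]
        by (simp add: B_def inner_product_on_def add_nonneg_pos)
    next
      case False
      then show ?thesis using M w1 w2 inner_product_on_nonneg[OF M w2]
        by (simp add: B_def inner_product_on_def add_pos_nonneg)
    qed
  qed
  have glin: "linear_form_on W (g w)" if w: "w \<in> W" for w
  proof -
    have w1: "fst w \<in> V" and w2: "snd w \<in> V" using w by (auto simp: W_def)
    show ?thesis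
      using inner_product_on_linear(2)[OF M minusV[OF a0 w1]] inner_product_on_linear(2)[OF M minusV[OF b0 w2]]
        inner_product_on_linear(2)[OF A w1] inner_product_on_linear(2)[OF A w2]
        T3[OF midV[of w] w1] T3[OF midV[of w] w2]
      unfolding linear_form_on_def g_def W_def by (auto simp: algebra_simps)
  qed
  have cf: "continuous_map_in_coords W V fst" and cs: "continuous_map_in_coords W V snd"
    using continuous_in_coords_linear[OF sW]
    by (auto simp: continuous_map_in_coords_def W_def linear_form_on_def)
  note ccomb = continuous_map_in_coords_comb2[OF sW sV]
  note cconst = continuous_map_in_coords_const
  have cupd: "continuous_map_in_coords W V (\<lambda>w. upd a0 (fst w))" "continuous_map_in_coords W V (\<lambda>w. upd b0 (snd w))"
    unfolding upd_def by (intro ccomb cf cs cconst a0 b0)+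
  have cs': "continuous_in_coords W (\<lambda>w. s w c)" if "c \<in> V" for c
    unfolding s_def
    by (intro continuous_in_coords_add continuous_in_coords_bilinear[OF sW V M, where B = "\<lambda>x y. T x y c"] T1 T2 cupd that)
  have c\<Phi>: "continuous_map_in_coords W V \<Phi>"
    unfolding \<Phi>_def using fV
    by (intro continuous_map_in_coords_lincomb[OF sW sV] cconst cs') auto
  have cmid: "continuous_map_in_coords W V mid"
    unfolding mid_def using \<phi>0 by (intro ccomb c\<Phi> cconst)
  have clin: "continuous_in_coords W (\<lambda>w. h (P w))" if "continuous_map_in_coords W V P" "linear_form_on V h" for h P
    using that by (simp add: continuous_map_in_coords_def)
  have gcont: "continuous_in_coords W (\<lambda>w. g w v)" if v: "v \<in> W" for v
  proof -
    have v1: "fst v \<in> V" and v2: "snd v \<in> V" using v by (auto simp: W_def)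
    have ca: "continuous_map_in_coords W V (\<lambda>w. fst w + (-1) *\<^sub>R a0)"
      and cb: "continuous_map_in_coords W V (\<lambda>w. snd w + (-1) *\<^sub>R b0)"
      using ccomb[OF cf cconst[OF a0], of 1 "-1"] ccomb[OF cs cconst[OF b0], of 1 "-1"] by simp_all
    show ?thesis unfolding g_def
      by (intro continuous_in_coords_add continuous_in_coords_diff continuous_in_coords_mult continuous_in_coords_const
          clin[OF ca inner_product_on_linear(1)[OF M v1]] clin[OF cb inner_product_on_linear(1)[OF M v2]]
          clin[OF cs inner_product_on_linear(1)[OF A v1]] clin[OF cf inner_product_on_linear(1)[OF A v2]]
          continuous_in_coords_bilinear[OF sW V M, where B = "\<lambda>x y. T x y (fst v)"]
          continuous_in_coords_bilinear[OF sW V M, where B = "\<lambda>x y. T x y (snd v)"] T1 T2 cmid cf cs v1 v2)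
  qed
  define K where "K = M a0 a0 + M b0 b0"
  have K: "K \<ge> 0" unfolding K_def using inner_product_on_nonneg[OF M] a0 b0 by simp
  \<comment> \<open>Cauchy-Schwarz in the form that avoids square roots: \<open>M (p - x) (p - x) \<ge> 0\<close>.\<close>
  have half: "2 * M (p + (-1) *\<^sub>R x) p \<ge> M p p - M x x" if x: "x \<in> V" and p: "p \<in> V" for x p
  proof -
    define d where "d = p + (-1) *\<^sub>R x"
    have d: "d \<in> V" using minusV[OF x p] by (simp add: d_def)
    have d1: "M d y = M p y - M x y" if "y \<in> V" for y
      unfolding d_def using linear_form_on_diff[OF inner_product_on_linear(1)[OF M that] sV p x] by simp
    have d2: "M d d = M d p - M d x"
      using linear_form_on_diff[OF inner_product_on_linear(2)[OF M d] sV p x] by (simp add: d_def)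
    have "M d d \<ge> 0" by (rule inner_product_on_nonneg[OF M d])
    moreover have "M x p = M p x" by (rule inner_product_on_linear(3)[OF M x p])
    ultimately show ?thesis using d1[OF x] d1[OF p] d2 unfolding d_def[symmetric] by linarith
  qed
  have "\<exists>w\<in>W. \<forall>v\<in>W. g w v = 0"
  proof (rule galerkin_zero[OF W Bip glin gcont])
    \<comment> \<open>Any radius whose square is at least \<open>K\<close> works; the summand \<open>1\<close> makes it positive when the old value is zero.\<close>
    show "sqrt (K + 1) > 0" using K by simp
    fix w assume w: "w \<in> W" and Bw: "B w w = (sqrt (K + 1))\<^sup>2"
    have w1: "fst w \<in> V" and w2: "snd w \<in> V" using w by (auto simp: W_def)
    \<comment> \<open>The terms with \<open>A\<close> and \<open>T\<close> cancel by symmetry.\<close>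
    have "g w w = \<mu> * (2 * M (fst w + (-1) *\<^sub>R a0) (fst w) + 2 * M (snd w + (-1) *\<^sub>R b0) (snd w))"
      using Tsym[OF midV w1 w2, of w] inner_product_on_linear(3)[OF A w1 w2]
      by (simp add: g_def algebra_simps)
    also have "\<dots> \<ge> 0"
    proof (intro mult_nonneg_nonneg)
      have "M (fst w) (fst w) + M (snd w) (snd w) = K + 1" using Bw K by (simp add: B_def)
      then show "0 \<le> 2 * M (fst w + (-1) *\<^sub>R a0) (fst w) + 2 * M (snd w + (-1) *\<^sub>R b0) (snd w)"
        using half[OF a0 w1] half[OF b0 w2] unfolding K_def by linarith
    qed (use \<mu> in simp)
    finally show "g w w \<ge> 0" .
  qed
  then obtain w where w: "w \<in> W" and gw: "\<And>v. v \<in> W \<Longrightarrow> g w v = 0" by blast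
  define p q where "p = fst w" and "q = snd w"
  have p: "p \<in> V" and q: "q \<in> V" using w by (auto simp: W_def p_def q_def)
  define a b where "a = upd a0 p" and "b = upd b0 q"
  have aV: "a \<in> V" and bV: "b \<in> V" using updV a0 b0 p q by (auto simp: a_def b_def)
  have pa: "(1/2) *\<^sub>R (a + a0) = p" and qb: "(1/2) *\<^sub>R (b + b0) = q"
    by (simp_all add: a_def b_def upd_def)
  have da: "\<mu> *\<^sub>R (a - a0) = (2 * \<mu>) *\<^sub>R (p + (-1) *\<^sub>R a0)"
    and db: "\<mu> *\<^sub>R (b - b0) = (2 * \<mu>) *\<^sub>R (q + (-1) *\<^sub>R b0)"
    by (simp_all add: a_def b_def upd_def algebra_simps flip: scaleR_2)
  have dm: "(1/2) *\<^sub>R (\<Phi> w + \<phi>0) = mid w" by (simp add: mid_def scaleR_right_distrib)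
  have zero: "h 0 = 0" if "linear_form_on V h" for h
    using linear_form_on_scale[OF that subspace_0[OF sV], of 0] by simp
  show ?thesis
  proof (intro bexI conjI ballI)
    fix c assume c: "c \<in> V"
    have z: "M (p + (-1) *\<^sub>R a0) 0 = 0" "M (q + (-1) *\<^sub>R b0) 0 = 0" "A p 0 = 0" "A q 0 = 0"
        "T (mid w) p 0 = 0" "T (mid w) q 0 = 0"
      by (intro zero inner_product_on_linear(2)[OF M] inner_product_on_linear(2)[OF A] minusV T3 midV a0 b0 p q)+
    have sc: "M (k *\<^sub>R x) c = k * M x c" if "x \<in> V" for k x
      by (rule linear_form_on_scale[OF inner_product_on_linear(1)[OF M c] that])
    show "M (\<mu> *\<^sub>R (a - a0)) c - A ((1/2) *\<^sub>R (b + b0)) c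
        - T ((1/2) *\<^sub>R (\<Phi> w + \<phi>0)) ((1/2) *\<^sub>R (b + b0)) c = 0"
      unfolding da qb dm sc[OF minusV[OF a0 p]]
      using gw[of "(c, 0)"] z c subspace_0[OF sV] by (simp add: g_def W_def flip: p_def q_def)
    show "M (\<mu> *\<^sub>R (b - b0)) c + A ((1/2) *\<^sub>R (a + a0)) c
        + T ((1/2) *\<^sub>R (\<Phi> w + \<phi>0)) ((1/2) *\<^sub>R (a + a0)) c = 0"
      unfolding db pa dm sc[OF minusV[OF b0 q]]
      using gw[of "(0, c)"] z c subspace_0[OF sV] by (simp add: g_def W_def flip: p_def q_def)
    show "S (\<Phi> w) c = T a a c + T b b c"
      unfolding \<Phi>_def using riesz_formula[OF sV S onb slin[OF w] c]
      by (simp add: s_def a_def b_def p_def q_def)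
  qed (use aV bV \<Phi>V in auto)
qed

section \<open>Gradients and essentially bounded functions\<close>

text \<open>
  Functions with pointwise operations form a real vector space; with this the finite element
  space is a subspace in the sense of the type class.
\<close>
instantiation "fun" :: (type, real_vector) real_vector
begin
definition scaleR_fun_def: "c *\<^sub>R f = (\<lambda>x. c *\<^sub>R f x)"
instance
  by standard (simp_all add: fun_eq_iff scaleR_fun_def scaleR_add_left scaleR_add_right)
end

lemma scaleR_fun_apply [simp]: "(c *\<^sub>R f) x = c *\<^sub>R f x"
  by (simp add: scaleR_fun_def)

lemma grad_eq:
  "(f has_derivative D) (at x) \<Longrightarrow> grad f x = (\<chi> i. D (axis i 1))"
  by (simp add: grad_def flip: frechet_derivative_at)

lemma has_derivative_grad:
  fixes f :: "real^'d::finite \<Rightarrow> real"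
  assumes "f differentiable at x"
  shows "(f has_derivative (\<lambda>h. grad f x \<bullet> h)) (at x)"
proof -
  obtain D where D: "(f has_derivative D) (at x)" using assms by (auto simp: differentiable_def)
  then interpret D: bounded_linear D by (rule has_derivative_bounded_linear)
  have "D h = grad f x \<bullet> h" for h
  proof -
    have "D h = D (\<Sum>i\<in>UNIV. h $ i *\<^sub>R axis i 1)"
      by (simp add: basis_expansion flip: scalar_mult_eq_scaleR)
    also have "\<dots> = grad f x \<bullet> h"
      by (simp add: D.sum D.scaleR grad_eq[OF D] inner_vec_def mult.commute)
    finally show ?thesis .
  qed
  then have "D = (\<lambda>h. grad f x \<bullet> h)" by blast
  then show ?thesis using D by simp
qed

lemma grad_add:
  fixes f g :: "real^'d::finite \<Rightarrow> real"
  assumes "f differentiable at x" "g differentiable at x"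
  shows "grad (f + g) x = grad f x + grad g x"
proof -
  have "(f + g has_derivative (\<lambda>h. grad f x \<bullet> h + grad g x \<bullet> h)) (at x)"
    using has_derivative_add[OF has_derivative_grad[OF assms(1)] has_derivative_grad[OF assms(2)]]
    by (simp add: plus_fun_def)
  then show ?thesis by (simp add: grad_eq vec_eq_iff inner_axis)
qed

lemma grad_scaleR:
  fixes f :: "real^'d::finite \<Rightarrow> real"
  assumes "f differentiable at x"
  shows "grad (c *\<^sub>R f) x = c *\<^sub>R grad f x"
proof -
  have "(c *\<^sub>R f has_derivative (\<lambda>h. c *\<^sub>R (grad f x \<bullet> h))) (at x)"
    using has_derivative_scaleR_right[OF has_derivative_grad[OF assms]] by (simp add: scaleR_fun_def)
  then show ?thesis by (simp add: grad_eq vec_eq_iff inner_axis)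
qed

lemma grad_complex:
  fixes f g :: "real^'d::finite \<Rightarrow> real"
  assumes "f differentiable at x" "g differentiable at x"
  shows "grad (\<lambda>x. complex_of_real (f x) + \<i> * complex_of_real (g x)) x $ i =
    complex_of_real (grad f x $ i) + \<i> * complex_of_real (grad g x $ i)"
proof -
  have "((\<lambda>x. complex_of_real (f x) + \<i> * complex_of_real (g x)) has_derivative
      (\<lambda>h. complex_of_real (grad f x \<bullet> h) + \<i> * complex_of_real (grad g x \<bullet> h))) (at x)"
    by (intro derivative_intros has_derivative_of_real has_derivative_grad assms)
  then show ?thesis by (simp add: grad_eq inner_axis)
qed

text \<open>
  The partial derivatives of a polynomial are again polynomials, by induction on its construction.
\<close>
lemma polynomial_grad:
  fixes p :: "real^'d::finite \<Rightarrow> real"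
  assumes "real_polynomial_function p"
  shows "p differentiable at x" "continuous_on UNIV (\<lambda>x. grad p x $ i)"
proof -
  show "p differentiable at x" for x
    by (rule differentiable_at_real_polynomial_function[OF assms])
  have "\<exists>q. real_polynomial_function q \<and> (\<forall>x. grad p x $ i = q x)"
    using assms
  proof (induction p rule: real_polynomial_function.induct)
    case (linear f)
    then have "grad f x $ i = f (axis i 1)" for x
      using grad_eq[OF bounded_linear_imp_has_derivative[OF linear]] by simp
    then show ?case by (intro exI[of _ "\<lambda>x. f (axis i 1)"]) auto
  next
    case (const c)
    have "grad (\<lambda>x. c) x $ i = 0" for x :: "real^'d" 
      using grad_eq[OF has_derivative_const[of c "at x"]] by simp
    then show ?case by (intro exI[of _ "\<lambda>x. 0"]) auto
  next
    case (add f g)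
    then obtain q r where q: "real_polynomial_function q" "\<And>x. grad f x $ i = q x"
      and r: "real_polynomial_function r" "\<And>x. grad g x $ i = r x" by blast
    have "grad (\<lambda>x. f x + g x) x $ i = q x + r x" for x
      using grad_add[of f x g] add.hyps q r
      by (simp add: differentiable_at_real_polynomial_function plus_fun_def)
    then show ?case using q r by (intro exI[of _ "\<lambda>x. q x + r x"]) auto
  next
    case (mult f g)
    then obtain q r where q: "real_polynomial_function q" "\<And>x. grad f x $ i = q x"
      and r: "real_polynomial_function r" "\<And>x. grad g x $ i = r x" by blast
    have "grad (\<lambda>x. f x * g x) x $ i = f x * r x + q x * g x" for x
      using grad_eq[OF has_derivative_mult[OF has_derivative_grad[OF differentiable_at_real_polynomial_function[OF mult.hyps(1)]]
         has_derivative_grad[OF differentiable_at_real_polynomial_function[OF mult.hyps(2)]]], of x] q r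
      by (simp add: inner_axis)
    then show ?case using q r mult.hyps by (intro exI[of _ "\<lambda>x. f x * r x + q x * g x"]) auto
  qed
  then obtain q where "real_polynomial_function q" "\<And>x. grad p x $ i = q x" by blast
  then show "continuous_on UNIV (\<lambda>x. grad p x $ i)"
    by (simp add: real_polynomial_function_eq continuous_on_polymonial_function)
qed

text \<open>
  The multi-indices of bounded degree number the monomials of a polynomial on an element, and
  so a part of the spanning functions of the finite element space.
\<close>
lemma finite_multiindices: "finite {k :: 'd::finite \<Rightarrow> nat. sum k UNIV \<le> r}"
proof (rule finite_subset)
  show "{k :: 'd \<Rightarrow> nat. sum k UNIV \<le> r} \<subseteq> PiE UNIV (\<lambda>_. {..r})"
  proof
    fix k :: "'d \<Rightarrow> nat" assume k: "k \<in> {k. sum k UNIV \<le> r}"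
    have "k i \<le> r" for i using member_le_sum[of i UNIV k] k by simp
    then show "k \<in> PiE UNIV (\<lambda>_. {..r})" by auto
  qed
qed (simp add: finite_PiE)

lemma polynomial_onD:
  fixes v :: "real^'d::finite \<Rightarrow> real"
  assumes "polynomial_on r K v"
  obtains p where "real_polynomial_function p" "\<And>x. x \<in> K \<Longrightarrow> v x = p x"
proof -
  have "real_polynomial_function (\<lambda>x. \<Sum>k | sum k UNIV \<le> r. c k * (\<Prod>i\<in>UNIV. x $ i ^ k i))" for c :: "('d \<Rightarrow> nat) \<Rightarrow> real"
    by (intro real_polynomial_function_sum finite_multiindices real_polynomial_function.intros(4) real_polynomial_function_prod
        real_polynomial_function_power real_polynomial_function.intros(1,2) bounded_linear_vec_nth) auto
  then show thesis using assms that unfolding polynomial_on_def by blast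
qed

text \<open>
  A class of functions that is closed under products and contained in \<open>L\<^sup>2\<close> over bounded
  domains; the finite element functions and their partial derivatives belong to it.
\<close>
definition Linf :: "(real^'d::finite) set \<Rightarrow> (real^'d \<Rightarrow> real) set" where
  "Linf \<Omega> = {f. f \<in> borel_measurable (lebesgue_on \<Omega>) \<and> (\<exists>C. AE x in lebesgue_on \<Omega>. \<bar>f x\<bar> \<le> C)}"

lemma Linf_add: "f \<in> Linf \<Omega> \<Longrightarrow> g \<in> Linf \<Omega> \<Longrightarrow> (\<lambda>x. f x + g x) \<in> Linf \<Omega>"
proof -
  assume f: "f \<in> Linf \<Omega>" and g: "g \<in> Linf \<Omega>"
  then obtain C D where "AE x in lebesgue_on \<Omega>. \<bar>f x\<bar> \<le> C" "AE x in lebesgue_on \<Omega>. \<bar>g x\<bar> \<le> D"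
    by (auto simp: Linf_def)
  then have "AE x in lebesgue_on \<Omega>. \<bar>f x + g x\<bar> \<le> C + D" by eventually_elim linarith
  then show ?thesis using f g by (auto simp: Linf_def)
qed

lemma Linf_mult: "f \<in> Linf \<Omega> \<Longrightarrow> g \<in> Linf \<Omega> \<Longrightarrow> (\<lambda>x. f x * g x) \<in> Linf \<Omega>"
proof -
  assume f: "f \<in> Linf \<Omega>" and g: "g \<in> Linf \<Omega>"
  then obtain C D where "AE x in lebesgue_on \<Omega>. \<bar>f x\<bar> \<le> C" "AE x in lebesgue_on \<Omega>. \<bar>g x\<bar> \<le> D"
    by (auto simp: Linf_def)
  then have "AE x in lebesgue_on \<Omega>. \<bar>f x * g x\<bar> \<le> C * D"
    by eventually_elim (auto simp: abs_mult intro: mult_mono')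
  then show ?thesis using f g by (auto simp: Linf_def)
qed

lemma integrable_Linf:
  assumes \<Omega>: "\<Omega> \<in> lmeasurable" and g: "g \<in> Linf \<Omega>"
  shows "integrable (lebesgue_on \<Omega>) g"
proof -
  obtain C where "AE x in lebesgue_on \<Omega>. norm (g x) \<le> C" using g by (auto simp: Linf_def)
  then show ?thesis using g
    by (intro finite_measure.integrable_const_bound[OF finite_measure_lebesgue_on[OF \<Omega>]]) (auto simp: Linf_def)
qed

lemma integrable_L2_mult_Linf:
  assumes \<Omega>: "\<Omega> \<in> lmeasurable" and f: "f \<in> L2 \<Omega>" and g: "g \<in> Linf \<Omega>"
  shows "integrable (lebesgue_on \<Omega>) (\<lambda>x. f x * g x)"
proof -
  interpret finite_measure "lebesgue_on \<Omega>" by (rule finite_measure_lebesgue_on[OF \<Omega>])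
  obtain C where C: "AE x in lebesgue_on \<Omega>. \<bar>g x\<bar> \<le> C" using g by (auto simp: Linf_def)
  show ?thesis
  proof (rule Bochner_Integration.integrable_bound)
    show "integrable (lebesgue_on \<Omega>) (\<lambda>x. \<bar>C\<bar> * (1 + (f x)\<^sup>2))"
      using f by (intro integrable_mult_right Bochner_Integration.integrable_add) (auto simp: L2_def)
    show "(\<lambda>x. f x * g x) \<in> borel_measurable (lebesgue_on \<Omega>)"
      using f g by (auto simp: L2_def Linf_def)
    have "\<bar>y\<bar> \<le> 1 + y\<^sup>2" for y :: real
      using sum_squares_bound[of "\<bar>y\<bar>" 1] by (simp add: power2_eq_square)
    then have bd: "norm (f x * g x) \<le> norm (\<bar>C\<bar> * (1 + (f x)\<^sup>2))" if "\<bar>g x\<bar> \<le> C" for x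
    proof -
      have "\<bar>g x\<bar> * \<bar>f x\<bar> \<le> \<bar>C\<bar> * (1 + (f x)\<^sup>2)"
        by (intro mult_mono \<open>\<And>y. \<bar>y\<bar> \<le> 1 + y\<^sup>2\<close>) (use that in auto)
      then show ?thesis by (simp add: abs_mult mult.commute)
    qed
    show "AE x in lebesgue_on \<Omega>. norm (f x * g x) \<le> norm (\<bar>C\<bar> * (1 + (f x)\<^sup>2))"
      using C by (rule eventually_mono) (rule bd)
  qed
qed

lemma Linf_subset_L2: 
  assumes \<Omega>: "\<Omega> \<in> lmeasurable" and g: "g \<in> Linf \<Omega>"
  shows "g \<in> L2 \<Omega>"
proof -
  have "integrable (lebesgue_on \<Omega>) (\<lambda>x. g x * g x)"
    by (rule integrable_Linf[OF \<Omega> Linf_mult[OF g g]])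
  then show ?thesis using g by (simp add: L2_def Linf_def power2_eq_square)
qed

text \<open>
  The set where \<open>f\<close> does not vanish is open in \<open>U\<close>, and a nonempty open set is not negligible.
\<close>
lemma continuous_AE_zero:
  fixes f :: "real^'d::finite \<Rightarrow> real"
  assumes U: "open U" "U \<subseteq> \<Omega>" and \<Omega>: "\<Omega> \<in> sets lebesgue" and f: "continuous_on U f"
    and ae: "AE x in lebesgue_on \<Omega>. f x = 0" and x: "x \<in> U"
  shows "f x = 0"
proof -
  have "AE x in lebesgue. x \<in> \<Omega> \<longrightarrow> f x = 0"
    using ae \<Omega> by (simp add: AE_restrict_space_iff)
  then obtain N where N: "N \<in> null_sets lebesgue" "{x. \<not> (x \<in> \<Omega> \<longrightarrow> f x = 0)} \<subseteq> N"
    unfolding completion.AE_iff_null_sets by (auto simp: eventually_ae_filter)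
  have op: "open (U \<inter> f -` (- {0}))"
    using f U(1) by (intro continuous_open_preimage) auto
  have "U \<inter> f -` (- {0}) \<subseteq> N" using N(2) U(2) by auto
  then have "negligible (U \<inter> f -` (- {0}))"
    using N(1) by (meson negligible_iff_null_sets negligible_subset)
  then show ?thesis using open_not_negligible[OF op] x by auto
qed

lemma sum_fun_apply: "(\<Sum>i\<in>I. f i) x = (\<Sum>i\<in>I. f i x)"
  by (induction I rule: infinite_finite_induct) auto

text \<open>
  This rests on the completeness of Lebesgue measure. It handles the gradient of a finite element
  function, about which nothing is known on the element boundaries.
\<close>
lemma borel_measurable_lebesgue_on_AE:
  fixes f g :: "'a::euclidean_space \<Rightarrow> 'b::euclidean_space"
  assumes S: "S \<in> sets lebesgue" and f: "f \<in> borel_measurable (lebesgue_on S)"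
    and ae: "AE x in lebesgue_on S. f x = g x"
  shows "g \<in> borel_measurable (lebesgue_on S)"
proof (rule borel_measurable_if_D, rule borel_measurable_AE)
  show "(\<lambda>x. if x \<in> S then f x else 0) \<in> borel_measurable lebesgue"
    by (rule borel_measurable_if_I[OF f S])
  have "AE x in lebesgue. x \<in> S \<longrightarrow> f x = g x"
    using ae S by (simp add: AE_restrict_space_iff)
  then show "AE x in lebesgue. (if x \<in> S then f x else 0) = (if x \<in> S then g x else 0)"
    by (rule eventually_mono) simp
qed

section \<open>Finite element spaces on a simplicial mesh\<close>

text \<open>
  An element acts through its interior, where finite element functions are polynomials and have a
  classical gradient; different elements are tied together by continuity alone.
\<close>
locale simplicial_mesh =
  fixes \<Omega> :: "(real^'d::finite) set" and \<T> :: "(real^'d) set set" and r :: nat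
  assumes open_domain: "open \<Omega>" and domain_nonempty: "\<Omega> \<noteq> {}"
    and bounded_domain: "bounded \<Omega>" and convex_domain: "convex \<Omega>"
    and finite_mesh: "finite \<T>" and compact_element: "K \<in> \<T> \<Longrightarrow> compact K"
    and convex_element: "K \<in> \<T> \<Longrightarrow> convex K" and interior_element: "K \<in> \<T> \<Longrightarrow> interior K \<noteq> {}"
    and cover: "\<Union>\<T> = closure \<Omega>"
begin

abbreviation V where "V \<equiv> fe_space \<Omega> \<T> r"

lemma lmeasurable_domain: "\<Omega> \<in> lmeasurable"
  by (rule lmeasurable_open[OF bounded_domain open_domain])

lemma sets_domain: "\<Omega> \<in> sets lebesgue"
  using lmeasurable_domain by (rule fmeasurableD)

lemma interior_element_subset: "K \<in> \<T> \<Longrightarrow> interior K \<subseteq> \<Omega>"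
proof -
  assume "K \<in> \<T>"
  then have "interior K \<subseteq> interior (closure \<Omega>)" using cover by (intro interior_mono) auto
  then show ?thesis
    using convex_interior_closure[OF convex_domain] open_domain by (simp add: interior_open)
qed

text \<open>
  The boundaries of the finitely many convex elements are negligible.
\<close>
lemma AE_interior: "AE x in lebesgue_on \<Omega>. \<exists>K\<in>\<T>. x \<in> interior K"
proof -
  have "negligible (\<Union>K\<in>\<T>. frontier K)"
    using finite_mesh convex_element by (intro negligible_Union) (auto intro: negligible_convex_frontier)
  then have "AE x in lebesgue. x \<notin> (\<Union>K\<in>\<T>. frontier K)"
    by (intro AE_not_in) (simp add: negligible_iff_null_sets)
  then have "AE x in lebesgue. x \<in> \<Omega> \<longrightarrow> (\<exists>K\<in>\<T>. x \<in> interior K)"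
  proof (rule eventually_mono, intro impI)
    fix x assume x: "x \<notin> (\<Union>K\<in>\<T>. frontier K)" "x \<in> \<Omega>"
    then have "x \<in> \<Union>\<T>" using cover closure_subset by blast
    then obtain K where "K \<in> \<T>" "x \<in> K" by blast
    then show "\<exists>K\<in>\<T>. x \<in> interior K" using x(1) closure_subset[of K] by (auto simp: frontier_def)
  qed
  then show ?thesis using sets_domain by (simp add: AE_restrict_space_iff)
qed

text \<open>
  By compactness of the elements each piece is bounded. A Borel function with the same values
  in the interiors of the elements is put together piece by piece, and agrees with \<open>g\<close>
  almost everywhere.
\<close>
lemma piecewise_continuous_Linf:
  assumes "\<And>K. K \<in> \<T> \<Longrightarrow> \<exists>q. continuous_on UNIV q \<and> (\<forall>x\<in>interior K. g x = q x)"
  shows "g \<in> Linf \<Omega>"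
proof -
  have "\<exists>G C. G \<in> borel_measurable borel \<and> (\<forall>x. \<bar>G x\<bar> \<le> C) \<and> (\<forall>x\<in>(\<Union>K\<in>S. interior K). g x = G x)"
    if "finite S" "S \<subseteq> \<T>" for S
    using that
  proof (induction S rule: finite_induct)
    case empty
    show ?case by (intro exI[of _ "\<lambda>x. 0"] exI[of _ 0]) auto
  next
    case (insert K S)
    have "S \<subseteq> \<T>" using insert.prems by simp
    from insert.IH[OF this] obtain G C where G: "G \<in> borel_measurable borel" "\<And>x. \<bar>G x\<bar> \<le> C"
      "\<And>x. x \<in> (\<Union>K\<in>S. interior K) \<Longrightarrow> g x = G x" by blast
    have K: "K \<in> \<T>" using insert.prems by simp
    obtain q where q: "continuous_on UNIV q" "\<And>x. x \<in> interior K \<Longrightarrow> g x = q x"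
      using assms[OF K] by blast
    have "compact (q ` K)"
      by (rule compact_continuous_image[OF continuous_on_subset[OF q(1)] compact_element[OF K]]) simp
    then obtain D where "\<forall>y\<in>q ` K. norm y \<le> D"
      using compact_imp_bounded bounded_iff by metis
    then have D: "\<bar>q x\<bar> \<le> D" if "x \<in> K" for x using that by simp
    define G' where "G' x = (if x \<in> interior K then q x else G x)" for x
    have "G' \<in> borel_measurable borel"
      unfolding G'_def using G(1) borel_measurable_continuous_onI[OF q(1)] by measurable
    moreover have "\<bar>G' x\<bar> \<le> max C D" for x
      using G(2)[of x] D[of x] interior_subset[of K] by (auto simp: G'_def)
    moreover have "g x = G' x" if "x \<in> (\<Union>K\<in>insert K S. interior K)" for x
      using that q(2) G(3) by (auto simp: G'_def)
    ultimately show ?case by blast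
  qed
  from this[OF finite_mesh order_refl] obtain G C where G: "G \<in> borel_measurable borel"
    "\<And>x. \<bar>G x\<bar> \<le> C" "\<And>x. x \<in> (\<Union>K\<in>\<T>. interior K) \<Longrightarrow> g x = G x" by blast
  have ae: "AE x in lebesgue_on \<Omega>. G x = g x"
    using AE_interior by (rule eventually_mono) (use G(3) in auto)
  have "G \<in> borel_measurable lebesgue" using G(1) by (intro measurable_completion) simp
  then have "g \<in> borel_measurable (lebesgue_on \<Omega>)"
    by (rule borel_measurable_lebesgue_on_AE[OF sets_domain measurable_restrict_space1 ae])
  moreover have "AE x in lebesgue_on \<Omega>. \<bar>g x\<bar> \<le> C"
    using ae by (rule eventually_mono) (use G(2) in metis)
  ultimately show ?thesis by (auto simp: Linf_def)
qed

lemma element_polynomial: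
  assumes "v \<in> V" "K \<in> \<T>"
  obtains p where "real_polynomial_function p" "\<And>x. x \<in> K \<Longrightarrow> v x = p x"
    "\<And>x. x \<in> interior K \<Longrightarrow> v differentiable at x \<and> grad v x = grad p x"
proof -
  have "polynomial_on r K v" using assms by (simp add: fe_space_def)
  then obtain p where p: "real_polynomial_function p" "\<And>x. x \<in> K \<Longrightarrow> v x = p x" by (rule polynomial_onD) blast
  have "v differentiable at x \<and> grad v x = grad p x" if x: "x \<in> interior K" for x
  proof -
    have "(v has_derivative (\<lambda>h. grad p x \<bullet> h)) (at x)"
      by (rule has_derivative_transform_within_open[OF has_derivative_grad[OF polynomial_grad(1)[OF p(1)]] open_interior x])
        (use p(2) interior_subset[of K] in auto)
    then show ?thesis by (auto simp: differentiable_def grad_eq vec_eq_iff inner_axis)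
  qed
  then show thesis using p that by blast
qed

lemma AE_differentiable:
  assumes "v \<in> V"
  shows "AE x in lebesgue_on \<Omega>. v differentiable at x"
  using AE_interior
proof (rule eventually_mono)
  fix x assume "\<exists>K\<in>\<T>. x \<in> interior K"
  then obtain K where K: "K \<in> \<T>" "x \<in> interior K" by blast
  then show "v differentiable at x" using element_polynomial[OF assms K(1)] by blast
qed

lemma fe_Linf: "v \<in> V \<Longrightarrow> v \<in> Linf \<Omega>"
proof (rule piecewise_continuous_Linf)
  fix K assume v: "v \<in> V" and K: "K \<in> \<T>"
  obtain p where p: "real_polynomial_function p" "\<And>x. x \<in> K \<Longrightarrow> v x = p x"
    "\<And>x. x \<in> interior K \<Longrightarrow> v differentiable at x \<and> grad v x = grad p x"
    by (rule element_polynomial[OF v K]) blast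
  then show "\<exists>q. continuous_on UNIV q \<and> (\<forall>x\<in>interior K. v x = q x)"
    by (intro exI[of _ p])
      (use interior_subset[of K] in \<open>auto simp: real_polynomial_function_eq continuous_on_polymonial_function\<close>)
qed

lemma fe_grad_Linf: "v \<in> V \<Longrightarrow> (\<lambda>x. grad v x $ i) \<in> Linf \<Omega>"
proof (rule piecewise_continuous_Linf)
  fix K assume v: "v \<in> V" and K: "K \<in> \<T>"
  obtain p where p: "real_polynomial_function p" "\<And>x. x \<in> K \<Longrightarrow> v x = p x"
    "\<And>x. x \<in> interior K \<Longrightarrow> v differentiable at x \<and> grad v x = grad p x"
    by (rule element_polynomial[OF v K]) blast
  then show "\<exists>q. continuous_on UNIV q \<and> (\<forall>x\<in>interior K. grad v x $ i = q x)"
    by (intro exI[of _ "\<lambda>x. grad p x $ i"]) (auto simp: polynomial_grad)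
qed

lemma subspace_fe: "subspace V"
proof (rule subspaceI)
  have "polynomial_on r K 0" for K :: "(real^'d) set"
    unfolding polynomial_on_def by (intro exI[of _ "\<lambda>k. 0"]) simp
  then show "0 \<in> V" by (simp add: fe_space_def zero_fun_def)
next
  fix v w assume v: "v \<in> V" and w: "w \<in> V"
  have "polynomial_on r K (v + w)" if K: "K \<in> \<T>" for K
  proof -
    have "polynomial_on r K v" "polynomial_on r K w" using v w K by (auto simp: fe_space_def)
    then obtain c d where
        "\<forall>x\<in>K. v x = (\<Sum>k | sum k UNIV \<le> r. c k * (\<Prod>i\<in>UNIV. x $ i ^ k i))"
        "\<forall>x\<in>K. w x = (\<Sum>k | sum k UNIV \<le> r. d k * (\<Prod>i\<in>UNIV. x $ i ^ k i))"
      unfolding polynomial_on_def by blast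
    then show ?thesis unfolding polynomial_on_def
      by (intro exI[of _ "\<lambda>k. c k + d k"]) (simp add: distrib_right sum.distrib)
  qed
  then show "v + w \<in> V" using v w by (auto simp: fe_space_def plus_fun_def intro: continuous_on_add)
next
  fix a v assume v: "v \<in> V"
  have "polynomial_on r K (a *\<^sub>R v)" if K: "K \<in> \<T>" for K
  proof -
    have "polynomial_on r K v" using v K by (auto simp: fe_space_def)
    then obtain c where
        "\<forall>x\<in>K. v x = (\<Sum>k | sum k UNIV \<le> r. c k * (\<Prod>i\<in>UNIV. x $ i ^ k i))"
      unfolding polynomial_on_def by blast
    then show ?thesis unfolding polynomial_on_def
      by (intro exI[of _ "\<lambda>k. a * c k"]) (simp add: sum_distrib_left mult.assoc)
  qed
  then show "a *\<^sub>R v \<in> V" using v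
    by (auto simp: fe_space_def scaleR_fun_def intro: continuous_on_mult_left)
qed

text \<open>
  To get spanning functions, choose for each point one element \<open>\<kappa> x\<close> that contains it;
  monomials cut off to the points with the same choice span a space that contains
  \<open>fe_space\<close>. They are in general discontinuous, hence no finite element functions themselves.
\<close>
lemma finite_dim_fe: "finite_dim_subspace V"
proof -
  define \<kappa> where "\<kappa> x = (SOME K. K \<in> \<T> \<and> x \<in> K)" for x
  define I where "I = {k :: 'd \<Rightarrow> nat. sum k UNIV \<le> r}"
  define b where "b K k = (\<lambda>x. if x \<in> \<Omega> \<and> \<kappa> x = K then \<Prod>i\<in>UNIV. x $ i ^ k i else 0 :: real)" for K k
  have I: "finite I" unfolding I_def by (rule finite_multiindices)
  have \<kappa>: "\<kappa> x \<in> \<T> \<and> x \<in> \<kappa> x" if "x \<in> \<Omega>" for x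
  proof -
    have "x \<in> \<Union>\<T>" using that cover closure_subset by blast
    then have "\<exists>K. K \<in> \<T> \<and> x \<in> K" by blast
    then show ?thesis unfolding \<kappa>_def by (rule someI_ex)
  qed
  have "V \<subseteq> span ((\<lambda>(K, k). b K k) ` (\<T> \<times> I))"
  proof
    fix v assume v: "v \<in> V"
    then have "\<forall>K\<in>\<T>. \<exists>c. \<forall>x\<in>K. v x = (\<Sum>k\<in>I. c k * (\<Prod>i\<in>UNIV. x $ i ^ k i))"
      by (simp add: fe_space_def polynomial_on_def I_def)
    then obtain c where c: "\<And>K x. K \<in> \<T> \<Longrightarrow> x \<in> K \<Longrightarrow> v x = (\<Sum>k\<in>I. c K k * (\<Prod>i\<in>UNIV. x $ i ^ k i))"
      by (metis (no_types))
    have "v = (\<Sum>K\<in>\<T>. \<Sum>k\<in>I. c K k *\<^sub>R b K k)"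
    proof
      fix x
      show "v x = (\<Sum>K\<in>\<T>. \<Sum>k\<in>I. c K k *\<^sub>R b K k) x"
      proof (cases "x \<in> \<Omega>")
        case True
        have "(\<Sum>K\<in>\<T>. \<Sum>k\<in>I. c K k *\<^sub>R b K k) x = (\<Sum>K\<in>\<T>. if K = \<kappa> x then v x else 0)"
          unfolding sum_fun_apply
        proof (rule sum.cong[OF refl])
          fix K assume K: "K \<in> \<T>"
          show "(\<Sum>k\<in>I. (c K k *\<^sub>R b K k) x) = (if K = \<kappa> x then v x else 0)"
            using c[OF K, of x] \<kappa>[OF True] True by (auto simp: b_def)
        qed
        then show ?thesis using \<kappa>[OF True] finite_mesh by simp
      next
        case False
        then show ?thesis using v by (simp add: sum_fun_apply b_def fe_space_def)
      qed
    qed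
    also have "\<dots> \<in> span ((\<lambda>(K, k). b K k) ` (\<T> \<times> I))"
      by (intro span_sum span_scale span_base) auto
    finally show "v \<in> span ((\<lambda>(K, k). b K k) ` (\<T> \<times> I))" .
  qed
  moreover have "finite ((\<lambda>(K, k). b K k) ` (\<T> \<times> I))" using finite_mesh I by simp
  ultimately show ?thesis using subspace_fe unfolding finite_dim_subspace_def by blast
qed

lemma continuous_on_fe: "v \<in> V \<Longrightarrow> continuous_on \<Omega> v"
  by (rule continuous_on_subset[OF _ closure_subset]) (simp add: fe_space_def)

lemma fe_outside: "v \<in> V \<Longrightarrow> x \<notin> \<Omega> \<Longrightarrow> v x = 0"
  by (simp add: fe_space_def)

lemma integrable_fe_mult:
  assumes "v \<in> V" "w \<in> V"
  shows "integrable (lebesgue_on \<Omega>) (\<lambda>x. v x * w x)"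
  by (intro integrable_Linf[OF lmeasurable_domain] Linf_mult fe_Linf assms)

lemma mass_inner_product: "inner_product_on V (ip_real \<Omega>)"
  unfolding inner_product_on_def
proof (intro conjI ballI impI)
  show "ip_real \<Omega> x y = ip_real \<Omega> y x" for x y by (simp add: ip_real_def mult.commute)
  show lin: "linear_form_on V (ip_real \<Omega> y)" if y: "y \<in> V" for y
    unfolding linear_form_on_def ip_real_def
    using integrable_fe_mult[OF y] by (auto simp: algebra_simps)
  have "(\<lambda>x. ip_real \<Omega> x y) = ip_real \<Omega> y" for y
    by (simp add: ip_real_def mult.commute fun_eq_iff)
  then show "linear_form_on V (\<lambda>x. ip_real \<Omega> x y)" if "y \<in> V" for y
    using lin[OF that] by simp
  fix v assume v: "v \<in> V" and "v \<noteq> 0"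
  have "ip_real \<Omega> v v \<noteq> 0"
  proof
    assume "ip_real \<Omega> v v = 0"
    then have ae: "AE x in lebesgue_on \<Omega>. v x = 0"
      using integral_nonneg_eq_0_iff_AE[OF integrable_fe_mult[OF v v]] by (simp add: ip_real_def)
    have "v x = 0" for x
      using continuous_AE_zero[OF open_domain order_refl sets_domain continuous_on_fe[OF v] ae]
        fe_outside[OF v] by blast
    then show False using \<open>v \<noteq> 0\<close> by (auto simp: fun_eq_iff)
  qed
  moreover have "ip_real \<Omega> v v \<ge> 0" by (simp add: ip_real_def)
  ultimately show "ip_real \<Omega> v v > 0" by simp
qed

lemma integrable_fe_grad:
  assumes g: "\<And>i. (\<lambda>x. g x $ i) \<in> L2 \<Omega>" and w: "w \<in> V"
  shows "integrable (lebesgue_on \<Omega>) (\<lambda>x. g x \<bullet> grad w x)"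
  unfolding inner_vec_def inner_real_def
  by (intro Bochner_Integration.integrable_sum integrable_L2_mult_Linf[OF lmeasurable_domain] g fe_grad_Linf w)

lemma fe_grad_L2: "v \<in> V \<Longrightarrow> (\<lambda>x. grad v x $ i) \<in> L2 \<Omega>"
  by (rule Linf_subset_L2[OF lmeasurable_domain fe_grad_Linf])

text \<open>
  Gradients of sums and multiples are additive and homogeneous only where the functions are
  differentiable, that is almost everywhere.
\<close>
lemma linear_ip_vec:
  assumes g: "\<And>i. (\<lambda>x. g x $ i) \<in> L2 \<Omega>"
  shows "linear_form_on V (\<lambda>w. ip_vec \<Omega> g (grad w))"
  unfolding linear_form_on_def
proof (intro conjI ballI allI)
  fix v w assume v: "v \<in> V" and w: "w \<in> V"
  have "ip_vec \<Omega> g (grad (v + w)) = (LINT x|lebesgue_on \<Omega>. g x \<bullet> grad v x + g x \<bullet> grad w x)"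
    unfolding ip_vec_def
  proof (rule integral_cong_AE)
    show "(\<lambda>x. g x \<bullet> grad (v + w) x) \<in> borel_measurable (lebesgue_on \<Omega>)"
      using integrable_fe_grad[OF g subspace_add[OF subspace_fe v w]] by simp
    show "(\<lambda>x. g x \<bullet> grad v x + g x \<bullet> grad w x) \<in> borel_measurable (lebesgue_on \<Omega>)"
      using integrable_fe_grad[OF g v] integrable_fe_grad[OF g w] by simp
    show "AE x in lebesgue_on \<Omega>. g x \<bullet> grad (v + w) x = g x \<bullet> grad v x + g x \<bullet> grad w x"
      using AE_differentiable[OF v] AE_differentiable[OF w]
      by eventually_elim (simp add: grad_add inner_add_right)
  qed
  then show "ip_vec \<Omega> g (grad (v + w)) = ip_vec \<Omega> g (grad v) + ip_vec \<Omega> g (grad w)"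
    using integrable_fe_grad[OF g v] integrable_fe_grad[OF g w] by (simp add: ip_vec_def)
next
  fix c v assume v: "v \<in> V"
  have "ip_vec \<Omega> g (grad (c *\<^sub>R v)) = (LINT x|lebesgue_on \<Omega>. c * (g x \<bullet> grad v x))"
    unfolding ip_vec_def
  proof (rule integral_cong_AE)
    show "(\<lambda>x. g x \<bullet> grad (c *\<^sub>R v) x) \<in> borel_measurable (lebesgue_on \<Omega>)"
      using integrable_fe_grad[OF g subspace_mul[OF subspace_fe v]] by simp
    show "(\<lambda>x. c * (g x \<bullet> grad v x)) \<in> borel_measurable (lebesgue_on \<Omega>)"
      using integrable_fe_grad[OF g v] by simp
    show "AE x in lebesgue_on \<Omega>. g x \<bullet> grad (c *\<^sub>R v) x = c * (g x \<bullet> grad v x)"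
      using AE_differentiable[OF v] by eventually_elim (simp add: grad_scaleR)
  qed
  then show "ip_vec \<Omega> g (grad (c *\<^sub>R v)) = c * ip_vec \<Omega> g (grad v)" by (simp add: ip_vec_def)
qed

text \<open>
  On each element the gradient is a polynomial that vanishes almost everywhere, so the function
  is constant there. A continuous function with finitely many values on the connected closure
  of the domain is constant, and the boundary values force the constant to be zero.
\<close>
lemma zero_of_grad_zero:
  assumes v: "v \<in> V" and ae: "AE x in lebesgue_on \<Omega>. grad v x = 0"
  shows "v = 0"
proof -
  have "\<exists>c. \<forall>x\<in>K. v x = c" if K: "K \<in> \<T>" for K
  proof -
    obtain p where p: "real_polynomial_function p" "\<And>x. x \<in> K \<Longrightarrow> v x = p x"
      "\<And>x. x \<in> interior K \<Longrightarrow> v differentiable at x \<and> grad v x = grad p x"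
      using element_polynomial[OF v K] by blast
    have z: "grad p x $ i = 0" if "x \<in> interior K" for x i
    proof -
      have "grad v x $ i = 0"
      proof (rule continuous_AE_zero[where f = "\<lambda>x. grad v x $ i"])
        show "continuous_on (interior K) (\<lambda>x. grad v x $ i)"
          using continuous_on_subset[OF polynomial_grad(2)[OF p(1), of i], of "interior K"] p(3)
          by (auto cong: continuous_on_cong)
        show "AE x in lebesgue_on \<Omega>. grad v x $ i = 0"
          using ae by (rule eventually_mono) simp
      qed (use that interior_element_subset[OF K] sets_domain in auto)
      then show ?thesis using p(3)[OF that] by simp
    qed
    have "\<exists>c. \<forall>x\<in>interior K. p x = c"
    proof (rule has_derivative_zero_constant)
      show "convex (interior K)" by (rule convex_interior[OF convex_element[OF K]])
      fix x assume x: "x \<in> interior K"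
      have "grad p x = 0" using z[OF x] by (simp add: vec_eq_iff)
      then show "(p has_derivative (\<lambda>h. 0)) (at x within interior K)"
        using has_derivative_at_withinI[OF has_derivative_grad[OF polynomial_grad(1)[OF p(1)]], of x "interior K"]
        by simp
    qed
    then obtain c where c: "\<And>x. x \<in> interior K \<Longrightarrow> p x = c" by blast
    have "closure (interior K) = K"
      using convex_closure_interior[OF convex_element[OF K] interior_element[OF K]]
        compact_imp_closed[OF compact_element[OF K]] by (simp add: closure_closed)
    moreover have "continuous_on (closure (interior K)) p"
      using p(1) by (simp add: real_polynomial_function_eq continuous_on_polymonial_function)
    ultimately have "v x = c" if "x \<in> K" for x
      using continuous_constant_on_closure[of "interior K" p c x] c that p(2) by simp
    then show ?thesis by blast
  qed
  then obtain c where c: "\<And>K x. K \<in> \<T> \<Longrightarrow> x \<in> K \<Longrightarrow> v x = c K" by metis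
  have "v ` closure \<Omega> \<subseteq> c ` \<T>" using c by (auto simp flip: cover)
  then have "finite (v ` closure \<Omega>)" using finite_mesh finite_subset by blast
  moreover have "connected (v ` closure \<Omega>)"
  proof (rule connected_continuous_image)
    show "continuous_on (closure \<Omega>) v" using v by (simp add: fe_space_def)
    show "connected (closure \<Omega>)" by (intro convex_connected convex_closure convex_domain)
  qed
  ultimately obtain a where a: "v ` closure \<Omega> = {a}"
    using domain_nonempty by (auto simp: connected_finite_iff_sing)
  have "frontier \<Omega> \<noteq> {}"
  proof
    assume "frontier \<Omega> = {}"
    then have "\<Omega> = UNIV" using domain_nonempty by (simp add: frontier_eq_empty)
    then show False using bounded_domain by simp
  qed
  then obtain y where y: "y \<in> closure \<Omega>" "y \<notin> \<Omega>"
    using open_domain by (auto simp: frontier_def interior_open)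
  have "v y = a" using a y(1) by blast
  then have "a = 0" using fe_outside[OF v y(2)] by simp
  have "v x = 0" for x
  proof (cases "x \<in> \<Omega>")
    case True
    then have "v x \<in> v ` closure \<Omega>" using closure_subset by blast
    then show ?thesis using a \<open>a = 0\<close> by simp
  qed (rule fe_outside[OF v])
  then show ?thesis by (simp add: fun_eq_iff)
qed

lemma energy_inner_product: "inner_product_on V (\<lambda>v w. ip_vec \<Omega> (grad v) (grad w))"
  unfolding inner_product_on_def
proof (intro conjI ballI impI)
  show "ip_vec \<Omega> (grad v) (grad w) = ip_vec \<Omega> (grad w) (grad v)" for v w
    by (simp add: ip_vec_def inner_commute)
  show lin: "linear_form_on V (\<lambda>w. ip_vec \<Omega> (grad y) (grad w))" if y: "y \<in> V" for y
    by (rule linear_ip_vec[OF fe_grad_L2[OF y]])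
  have "(\<lambda>x. ip_vec \<Omega> (grad x) (grad y)) = (\<lambda>x. ip_vec \<Omega> (grad y) (grad x))" for y
    by (simp add: ip_vec_def inner_commute)
  then show "linear_form_on V (\<lambda>x. ip_vec \<Omega> (grad x) (grad y))" if "y \<in> V" for y
    using lin[OF that] by simp
  fix v assume v: "v \<in> V" and "v \<noteq> 0"
  have "ip_vec \<Omega> (grad v) (grad v) \<noteq> 0"
  proof
    assume "ip_vec \<Omega> (grad v) (grad v) = 0"
    then have "AE x in lebesgue_on \<Omega>. grad v x = 0"
      using integral_nonneg_eq_0_iff_AE[OF integrable_fe_grad[OF fe_grad_L2[OF v] v]] by (simp add: ip_vec_def)
    then show False using zero_of_grad_zero[OF v] \<open>v \<noteq> 0\<close> by simp
  qed
  moreover have "ip_vec \<Omega> (grad v) (grad v) \<ge> 0" by (simp add: ip_vec_def)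
  ultimately show "ip_vec \<Omega> (grad v) (grad v) > 0" by simp
qed

text \<open>
  The definite description in \<open>ritz\<close> is meaningful because the orthogonality condition is a
  linear problem for the gradient inner product; its right-hand side is finite since
  a weak gradient is square-integrable.
\<close>
lemma ritz_in_fe:
  assumes v: "v \<in> H10 \<Omega>"
  shows "ritz \<Omega> V v \<in> V"
proof -
  define g where "g = weak_grad \<Omega> v"
  have "v \<in> H1 \<Omega>" using v unfolding H10_def by blast
  then have "\<exists>g. has_weak_gradient \<Omega> v g" unfolding H1_def by blast
  then have "has_weak_gradient \<Omega> v g" unfolding g_def weak_grad_def by (rule someI_ex)
  then have g: "(\<lambda>x. g x $ i) \<in> L2 \<Omega>" for i by (simp add: has_weak_gradient_def)
  have split: "ip_vec \<Omega> (\<lambda>x. g x - grad z x) (grad w) = ip_vec \<Omega> g (grad w) - ip_vec \<Omega> (grad z) (grad w)"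
    if "z \<in> V" "w \<in> V" for z w
    unfolding ip_vec_def inner_diff_left
    by (rule Bochner_Integration.integral_diff[OF integrable_fe_grad[OF g that(2)] integrable_fe_grad[OF fe_grad_L2[OF that(1)] that(2)]])
  have "\<exists>!z. z \<in> V \<and> (\<forall>w\<in>V. ip_vec \<Omega> (grad z) (grad w) = ip_vec \<Omega> g (grad w))"
    by (rule riesz_representation[OF finite_dim_fe energy_inner_product linear_ip_vec[OF g]])
  moreover have "(z \<in> V \<and> (\<forall>w\<in>V. ip_vec \<Omega> (grad z) (grad w) = ip_vec \<Omega> g (grad w))) \<longleftrightarrow>
      (z \<in> V \<and> (\<forall>w\<in>V. ip_vec \<Omega> (\<lambda>x. weak_grad \<Omega> v x - grad z x) (grad w) = 0))" for z
    using split by (auto simp flip: g_def)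
  ultimately have "\<exists>!z. z \<in> V \<and> (\<forall>w\<in>V. ip_vec \<Omega> (\<lambda>x. weak_grad \<Omega> v x - grad z x) (grad w) = 0)"
    by simp
  from theI'[OF this] show ?thesis unfolding ritz_def by (rule conjunct1)
qed

end

section \<open>Solvability of the fully discrete scheme\<close>

lemma integral_complex_pair:
  assumes "integrable M f" "integrable M g"
  shows "(LINT x|M. complex_of_real (f x) + \<i> * complex_of_real (g x)) =
    complex_of_real (LINT x|M. f x) + \<i> * complex_of_real (LINT x|M. g x)"
proof -
  have "integrable M (\<lambda>x. complex_of_real (f x))" "integrable M (\<lambda>x. \<i> * complex_of_real (g x))"
    using assms by (auto intro: integrable_of_real)
  then show ?thesis by simp
qed

text \<open>
  Complex functions are handled as pairs of real ones, which turns the complex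
  equations into the real system of \<open>crank_nicolson_step\<close>.
\<close>
definition complex_pair :: "('a \<Rightarrow> real) \<Rightarrow> ('a \<Rightarrow> real) \<Rightarrow> 'a \<Rightarrow> complex" where
  "complex_pair a b = (\<lambda>x. complex_of_real (a x) + \<i> * complex_of_real (b x))"

lemma complexify_eq: "complexify V = {complex_pair a b | a b. a \<in> V \<and> b \<in> V}"
  by (simp add: complexify_def complex_pair_def)

lemma complex_pair_scaleR: "complex_pair (k *\<^sub>R f) (k *\<^sub>R g) x = k *\<^sub>R complex_pair f g x"
  and complex_pair_add: "complex_pair (f + f') (g + g') x = complex_pair f g x + complex_pair f' g' x"
  and complex_pair_diff: "complex_pair (f - f') (g - g') x = complex_pair f g x - complex_pair f' g' x"
  by (simp_all add: complex_pair_def complex_eq_iff)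

lemma backward_diff_complex_pair:
  "backward_diff \<tau> (\<lambda>n. complex_pair (a n) (b n)) n =
     complex_pair ((1 / \<tau>) *\<^sub>R (a n - a (n - 1))) ((1 / \<tau>) *\<^sub>R (b n - b (n - 1)))"
  by (rule ext) (simp only: backward_diff_def complex_pair_scaleR complex_pair_diff inverse_eq_divide)

lemma time_avg_complex_pair:
  "time_avg (\<lambda>n. complex_pair (a n) (b n)) n =
     complex_pair ((1 / 2) *\<^sub>R (a n + a (n - 1))) ((1 / 2) *\<^sub>R (b n + b (n - 1)))"
  by (rule ext) (simp only: time_avg_def complex_pair_scaleR complex_pair_add inverse_eq_divide)

lemma ip_complex_pair:
  assumes \<Omega>: "\<Omega> \<in> lmeasurable" and L: "p \<in> Linf \<Omega>" "q \<in> Linf \<Omega>" "c \<in> Linf \<Omega>" "d \<in> Linf \<Omega>"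
  shows "ip_complex \<Omega> (complex_pair p q) (complex_pair c d) =
    complex_of_real (ip_real \<Omega> p c + ip_real \<Omega> q d) + \<i> * complex_of_real (ip_real \<Omega> q c - ip_real \<Omega> p d)"
proof -
  have I: "integrable (lebesgue_on \<Omega>) (\<lambda>x. f x * g x)" if "f \<in> Linf \<Omega>" "g \<in> Linf \<Omega>" for f g
    by (rule integrable_Linf[OF \<Omega> Linf_mult[OF that]])
  note Is = I[OF L(1,3)] I[OF L(2,4)] I[OF L(2,3)] I[OF L(1,4)]
  have "ip_complex \<Omega> (complex_pair p q) (complex_pair c d) =
      (LINT x|lebesgue_on \<Omega>. complex_of_real (p x * c x + q x * d x) + \<i> * complex_of_real (q x * c x - p x * d x))"
    unfolding ip_complex_def complex_pair_def
    by (intro Bochner_Integration.integral_cong refl) (simp add: complex_eq_iff)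
  also have "\<dots> = complex_of_real (LINT x|lebesgue_on \<Omega>. p x * c x + q x * d x)
      + \<i> * complex_of_real (LINT x|lebesgue_on \<Omega>. q x * c x - p x * d x)"
    using Is by (intro integral_complex_pair) simp_all
  finally show ?thesis using Is by (simp add: ip_real_def)
qed

context simplicial_mesh
begin

lemma ip_complex_vec_pair:
  assumes V: "p \<in> V" "q \<in> V" "c \<in> V" "d \<in> V"
  shows "ip_complex_vec \<Omega> (grad (complex_pair p q)) (grad (complex_pair c d)) =
    complex_of_real (ip_vec \<Omega> (grad p) (grad c) + ip_vec \<Omega> (grad q) (grad d))
    + \<i> * complex_of_real (ip_vec \<Omega> (grad q) (grad c) - ip_vec \<Omega> (grad p) (grad d))"
proof -
  have I: "integrable (lebesgue_on \<Omega>) (\<lambda>x. grad v x \<bullet> grad w x)" if "v \<in> V" "w \<in> V" for v w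
    by (rule integrable_fe_grad[OF fe_grad_L2[OF that(1)] that(2)])
  note Is = I[OF V(1,3)] I[OF V(2,4)] I[OF V(2,3)] I[OF V(1,4)]
  define R where "R x = grad p x \<bullet> grad c x + grad q x \<bullet> grad d x" for x
  define J where "J x = grad q x \<bullet> grad c x - grad p x \<bullet> grad d x" for x
  have RJ: "integrable (lebesgue_on \<Omega>) R" "integrable (lebesgue_on \<Omega>) J"
    using Is by (simp_all add: R_def[abs_def] J_def[abs_def])
  \<comment> \<open>The integrand itself is known only almost everywhere, at the points where the four functions
    are differentiable.\<close>
  define f where "f x = (\<Sum>i\<in>UNIV. grad (complex_pair p q) x $ i * cnj (grad (complex_pair c d) x $ i))" for x
  have ae: "AE x in lebesgue_on \<Omega>. f x = complex_of_real (R x) + \<i> * complex_of_real (J x)"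
    using AE_differentiable[OF V(1)] AE_differentiable[OF V(2)] AE_differentiable[OF V(3)] AE_differentiable[OF V(4)]
  proof eventually_elim
    case (elim x)
    then show ?case
      by (simp add: f_def R_def J_def complex_pair_def grad_complex inner_vec_def complex_eq_iff
          sum.distrib sum_subtractf)
  qed
  have "(LINT x|lebesgue_on \<Omega>. f x) = (LINT x|lebesgue_on \<Omega>. complex_of_real (R x) + \<i> * complex_of_real (J x))"
  proof (rule integral_cong_AE[OF _ _ ae])
    show m: "(\<lambda>x. complex_of_real (R x) + \<i> * complex_of_real (J x)) \<in> borel_measurable (lebesgue_on \<Omega>)"
      using RJ by simp
    show "f \<in> borel_measurable (lebesgue_on \<Omega>)"
      by (rule borel_measurable_lebesgue_on_AE[OF sets_domain m])
        (use ae in \<open>rule eventually_mono; simp\<close>)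
  qed
  also have "\<dots> = complex_of_real (LINT x|lebesgue_on \<Omega>. R x) + \<i> * complex_of_real (LINT x|lebesgue_on \<Omega>. J x)"
    by (rule integral_complex_pair[OF RJ])
  finally show ?thesis using Is
    by (simp add: ip_complex_vec_def ip_vec_def f_def[abs_def] R_def[abs_def] J_def[abs_def])
qed

lemma potential_trilinear:
  "symmetric_trilinear_on V (\<lambda>f g h. LINT x|lebesgue_on \<Omega>. f x * g x * h x)" (is "symmetric_trilinear_on V ?T")
proof -
  have I: "integrable (lebesgue_on \<Omega>) (\<lambda>x. f x * g x * h x)" if "f \<in> V" "g \<in> V" "h \<in> V" for f g h
    by (intro integrable_Linf[OF lmeasurable_domain] Linf_mult fe_Linf that)
  have lin: "linear_form_on V (?T f g)" if "f \<in> V" "g \<in> V" for f g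
    unfolding linear_form_on_def using I[OF that] by (auto simp: distrib_left mult.left_commute)
  moreover have "(\<lambda>z. ?T f z g) = ?T f g" "(\<lambda>z. ?T z f g) = ?T f g" for f g
    by (simp_all add: fun_eq_iff ac_simps)
  ultimately show ?thesis by (simp add: symmetric_trilinear_on_def ac_simps)
qed

text \<open>
  The gradient part alone is definite, which covers the Poisson case \<open>\<alpha> = 0\<close>.
\<close>
lemma helmholtz_inner_product:
  assumes "\<alpha> \<ge> 0" "\<beta> \<noteq> 0"
  shows "inner_product_on V (\<lambda>v w. \<alpha> * ip_real \<Omega> v w + \<beta>\<^sup>2 * ip_vec \<Omega> (grad v) (grad w))"
proof -
  note M = mass_inner_product and A = energy_inner_product
  have lin: "linear_form_on V (\<lambda>v. \<alpha> * f v + \<beta>\<^sup>2 * g v)" if "linear_form_on V f" "linear_form_on V g" for f g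
    using that by (auto simp: linear_form_on_def algebra_simps)
  show ?thesis
    unfolding inner_product_on_def
  proof (intro conjI ballI impI lin inner_product_on_linear[OF M] inner_product_on_linear[OF A])
    fix v w assume "v \<in> V" "w \<in> V"
    then show "\<alpha> * ip_real \<Omega> v w + \<beta>\<^sup>2 * ip_vec \<Omega> (grad v) (grad w)
        = \<alpha> * ip_real \<Omega> w v + \<beta>\<^sup>2 * ip_vec \<Omega> (grad w) (grad v)"
      using inner_product_on_linear(3)[OF M] inner_product_on_linear(3)[OF A] by simp
  next
    fix v assume v: "v \<in> V" and nz: "v \<noteq> 0"
    have "ip_vec \<Omega> (grad v) (grad v) > 0" using A v nz by (simp add: inner_product_on_def)
    then show "0 < \<alpha> * ip_real \<Omega> v v + \<beta>\<^sup>2 * ip_vec \<Omega> (grad v) (grad v)"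
      using inner_product_on_nonneg[OF M v] assms by (intro add_nonneg_pos mult_nonneg_nonneg mult_pos_pos) auto
  qed
qed

text \<open>
  Dependent choice along the time levels, starting from the Ritz projections. The real
  equations tested with the real and imaginary parts \<open>c\<close>, \<open>d\<close> of a complex test function combine to its complex
  equation.
\<close>
theorem scheme_solution_exists:
  assumes \<tau>: "\<tau> > 0" and \<alpha>: "\<alpha> \<ge> 0" and \<beta>: "\<beta> \<noteq> 0"
    and u0: "u0 \<in> H10_complex \<Omega>" and \<phi>0: "\<phi>0 \<in> H10 \<Omega>"
  shows "\<exists>u \<phi>. scheme_solution \<Omega> V \<alpha> \<beta> \<tau> N u0 \<phi>0 u \<phi>"
proof -
  define A where "A v w = ip_vec \<Omega> (grad v) (grad w)" for v w :: "real^'d \<Rightarrow> real"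
  define S where "S v w = \<alpha> * ip_real \<Omega> v w + \<beta>\<^sup>2 * ip_vec \<Omega> (grad v) (grad w)" for v w
  define T where "T f g h = (LINT x|lebesgue_on \<Omega>. f x * g x * h x)" for f g h :: "real^'d \<Rightarrow> real"
  define start where "start = (ritz \<Omega> V (\<lambda>y. Re (u0 y)), ritz \<Omega> V (\<lambda>y. Im (u0 y)), ritz \<Omega> V \<phi>0)"
  define step where "step = (\<lambda>(a0, b0, \<phi>0) (a, b, \<phi>).
     (\<forall>c\<in>V. ip_real \<Omega> ((1 / \<tau>) *\<^sub>R (a - a0)) c - A ((1/2) *\<^sub>R (b + b0)) c
        - T ((1/2) *\<^sub>R (\<phi> + \<phi>0)) ((1/2) *\<^sub>R (b + b0)) c = 0) \<and>
     (\<forall>c\<in>V. ip_real \<Omega> ((1 / \<tau>) *\<^sub>R (b - b0)) c + A ((1/2) *\<^sub>R (a + a0)) c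
        + T ((1/2) *\<^sub>R (\<phi> + \<phi>0)) ((1/2) *\<^sub>R (a + a0)) c = 0) \<and>
     (\<forall>c\<in>V. S \<phi> c = T a a c + T b b c))"
  have "\<exists>s. \<forall>n. (s n \<in> V \<times> V \<times> V \<and> (n = 0 \<longrightarrow> s n = start)) \<and> step (s n) (s (Suc n))"
  proof (rule dependent_nat_choice)
    show "\<exists>x. x \<in> V \<times> V \<times> V \<and> (0 = (0::nat) \<longrightarrow> x = start)"
      using u0 \<phi>0 ritz_in_fe by (intro exI[of _ start]) (simp add: start_def H10_complex_def)
    fix x :: "(real^'d \<Rightarrow> real) \<times> (real^'d \<Rightarrow> real) \<times> (real^'d \<Rightarrow> real)" and n :: nat
    assume x: "x \<in> V \<times> V \<times> V \<and> (n = 0 \<longrightarrow> x = start)"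
    obtain a0 b0 \<psi> where abp: "x = (a0, b0, \<psi>)" by (cases x) auto
    then have "a0 \<in> V" "b0 \<in> V" "\<psi> \<in> V" using x by auto
    then obtain a b \<phi> where "a \<in> V" "b \<in> V" "\<phi> \<in> V" "step x (a, b, \<phi>)"
      using crank_nicolson_step[OF finite_dim_fe mass_inner_product energy_inner_product
          helmholtz_inner_product[OF \<alpha> \<beta>] potential_trilinear, of "1 / \<tau>" a0 b0 \<psi>] \<tau>
      unfolding step_def abp A_def S_def T_def by auto
    then show "\<exists>y. (y \<in> V \<times> V \<times> V \<and> (Suc n = 0 \<longrightarrow> y = start)) \<and> step x y"
      by (intro exI[of _ "(a, b, \<phi>)"]) simp
  qed
  then obtain s where s: "\<And>n. s n \<in> V \<times> V \<times> V" "s 0 = start" "\<And>n. step (s n) (s (Suc n))" by blast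
  define a b \<phi> where "a n = fst (s n)" and "b n = fst (snd (s n))" and "\<phi> n = snd (snd (s n))" for n
  have sn: "s n = (a n, b n, \<phi> n)" for n by (simp add: a_def b_def \<phi>_def)
  have V: "a n \<in> V" "b n \<in> V" "\<phi> n \<in> V" for n using s(1)[of n] by (auto simp: sn)
  define u where "u = (\<lambda>n. complex_pair (a n) (b n))"
  have "scheme_solution \<Omega> V \<alpha> \<beta> \<tau> N u0 \<phi>0 u \<phi>"
    unfolding scheme_solution_def
  proof (intro conjI ballI)
    have init: "a 0 = ritz \<Omega> V (\<lambda>y. Re (u0 y))" "b 0 = ritz \<Omega> V (\<lambda>y. Im (u0 y))" "\<phi> 0 = ritz \<Omega> V \<phi>0"
      using s(2) by (simp_all add: sn start_def)
    show "u 0 = ritz_complex \<Omega> V u0"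
      by (simp add: fun_eq_iff u_def complex_pair_def ritz_complex_def init complex_eq_iff)
    show "\<phi> 0 = ritz \<Omega> V \<phi>0" by (rule init)
    fix n assume n: "n \<in> {1..N}"
    show "u n \<in> complexify V" using V by (auto simp: complexify_eq u_def)
    show "\<phi> n \<in> V" by (rule V)
    define P Q \<Phi> where "P = (1/2) *\<^sub>R (a n + a (n - 1))" and "Q = (1/2) *\<^sub>R (b n + b (n - 1))"
      and "\<Phi> = (1/2) *\<^sub>R (\<phi> n + \<phi> (n - 1))"
    define p q where "p = (1 / \<tau>) *\<^sub>R (a n - a (n - 1))" and "q = (1 / \<tau>) *\<^sub>R (b n - b (n - 1))"
    have PQ: "P \<in> V" "Q \<in> V" "\<Phi> \<in> V" "p \<in> V" "q \<in> V"
      unfolding P_def Q_def \<Phi>_def p_def q_def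
      by (intro subspace_mul[OF subspace_fe] subspace_add[OF subspace_fe] subspace_diff[OF subspace_fe] V)+
    have st: "step (s (n - 1)) (s n)" using s(3)[of "n - 1"] n by simp
    have E1: "ip_real \<Omega> p c - A Q c - T \<Phi> Q c = 0" if "c \<in> V" for c
      using st that unfolding step_def sn p_def P_def Q_def \<Phi>_def by simp
    have E2: "ip_real \<Omega> q c + A P c + T \<Phi> P c = 0" if "c \<in> V" for c
      using st that unfolding step_def sn q_def P_def Q_def \<Phi>_def by simp
    have E3: "S (\<phi> n) c = T (a n) (a n) c + T (b n) (b n) c" if "c \<in> V" for c
      using st that unfolding step_def sn by simp
    show "\<i> * ip_complex \<Omega> (backward_diff \<tau> u n) v - ip_complex_vec \<Omega> (grad (time_avg u n)) (grad v)
        - ip_complex \<Omega> (\<lambda>x. complex_of_real (time_avg \<phi> n x) * time_avg u n x) v = 0"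
      if vV: "v \<in> complexify V" for v
    proof -
      obtain c d where cd: "c \<in> V" "d \<in> V" and v: "v = complex_pair c d"
        using vV unfolding complexify_eq by blast
      have diff: "backward_diff \<tau> u n = complex_pair p q"
        unfolding u_def p_def q_def by (rule backward_diff_complex_pair)
      have avg: "time_avg u n = complex_pair P Q"
        unfolding u_def P_def Q_def by (rule time_avg_complex_pair)
      have pot: "(\<lambda>x. complex_of_real (time_avg \<phi> n x) * time_avg u n x)
          = complex_pair (\<lambda>x. \<Phi> x * P x) (\<lambda>x. \<Phi> x * Q x)"
        unfolding avg
        by (rule ext) (simp add: \<Phi>_def time_avg_def complex_pair_def complex_eq_iff)
      have "ip_complex \<Omega> (backward_diff \<tau> u n) v =
          complex_of_real (ip_real \<Omega> p c + ip_real \<Omega> q d) + \<i> * complex_of_real (ip_real \<Omega> q c - ip_real \<Omega> p d)"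
        unfolding diff v by (intro ip_complex_pair lmeasurable_domain fe_Linf PQ cd)
      moreover have "ip_complex_vec \<Omega> (grad (time_avg u n)) (grad v) =
          complex_of_real (A P c + A Q d) + \<i> * complex_of_real (A Q c - A P d)"
        unfolding avg v A_def by (intro ip_complex_vec_pair PQ cd)
      moreover have "ip_complex \<Omega> (\<lambda>x. complex_of_real (time_avg \<phi> n x) * time_avg u n x) v =
          complex_of_real (T \<Phi> P c + T \<Phi> Q d) + \<i> * complex_of_real (T \<Phi> Q c - T \<Phi> P d)"
        unfolding pot v T_def
        by (subst ip_complex_pair) (auto simp: ip_real_def intro: lmeasurable_domain Linf_mult fe_Linf PQ cd)
      ultimately show ?thesis
        using E1[OF cd(1)] E1[OF cd(2)] E2[OF cd(1)] E2[OF cd(2)] by (simp add: complex_eq_iff)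
    qed
    show "\<alpha> * ip_real \<Omega> (\<phi> n) w + \<beta>\<^sup>2 * ip_vec \<Omega> (grad (\<phi> n)) (grad w) = ip_real \<Omega> (\<lambda>x. (cmod (u n x))\<^sup>2) w"
      if w: "w \<in> V" for w
    proof -
      have I: "integrable (lebesgue_on \<Omega>) (\<lambda>x. f x * f x * w x)" if "f \<in> V" for f
        by (intro integrable_Linf[OF lmeasurable_domain] Linf_mult fe_Linf that w)
      have "(cmod (u n x))\<^sup>2 = (a n x)\<^sup>2 + (b n x)\<^sup>2" for x
        by (simp add: u_def complex_pair_def cmod_power2)
      then have "ip_real \<Omega> (\<lambda>x. (cmod (u n x))\<^sup>2) w =
          (LINT x|lebesgue_on \<Omega>. a n x * a n x * w x + b n x * b n x * w x)"
        by (simp add: ip_real_def power2_eq_square distrib_right)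
      also have "\<dots> = T (a n) (a n) w + T (b n) (b n) w"
        unfolding T_def by (rule Bochner_Integration.integral_add[OF I[OF V(1)] I[OF V(2)]])
      finally show ?thesis using E3[OF w] by (simp add: S_def)
    qed
  qed
  then show ?thesis by blast
qed

end

theorem theorem4p1:
  fixes \<Omega> :: "(real^'d::finite) set"
    and H :: "real set" and \<T> :: "real \<Rightarrow> (real^'d) set set"
    and T \<alpha> \<beta> :: real and r :: nat
    and u0 :: "real^'d \<Rightarrow> complex" and \<phi>0 :: "real^'d \<Rightarrow> real"
  assumes "CARD('d) = 2 \<or> CARD('d) = 3"
    and "convex_polytopal_domain \<Omega>"
    and "T > 0"
    and "\<alpha> \<ge> 0" and "\<beta> \<ge> 0"
    and "(\<alpha> \<noteq> 0 \<and> \<beta> \<noteq> 0) \<or> (\<alpha> = 0 \<and> \<beta> = 1)"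
    and "u0 \<in> H10_complex \<Omega>" and "\<phi>0 \<in> H10 \<Omega>"
    and "quasi_uniform_family \<Omega> H \<T>"
    and "r \<ge> 1"
  shows "\<forall>h\<in>H. \<forall>N>0. \<exists>u \<phi>.
           scheme_solution \<Omega> (fe_space \<Omega> (\<T> h) r) \<alpha> \<beta> (T / real N) N u0 \<phi>0 u \<phi>"
proof (intro ballI allI impI)
  fix h and N :: nat assume h: "h \<in> H" and N: "N > 0"
  have h0: "h > 0" and part: "simplicial_partition \<Omega> (\<T> h)"
    using assms(9) h by (auto simp: quasi_uniform_family_def)
  obtain \<sigma> where \<sigma>: "\<sigma> > 0" "\<forall>K\<in>\<T> h. \<exists>x. cball x (\<sigma> * h) \<subseteq> K"
    using assms(9) h unfolding quasi_uniform_family_def by blast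
  interpret simplicial_mesh \<Omega> "\<T> h" r
  proof
    show "open \<Omega>" "\<Omega> \<noteq> {}" "bounded \<Omega>" "convex \<Omega>"
      using assms(2) by (auto simp: convex_polytopal_domain_def)
    show "finite (\<T> h)" "\<Union>(\<T> h) = closure \<Omega>" using part by (auto simp: simplicial_partition_def)
    fix K assume K: "K \<in> \<T> h"
    then have simplex: "int CARD('d) simplex K" using part by (auto simp: simplicial_partition_def)
    show "compact K" by (rule compact_simplex[OF simplex])
    show "convex K" by (rule convex_simplex[OF simplex])
    \<comment> \<open>The ball that quasi-uniformity puts into each element shows that it has interior points.\<close>
    obtain x where "cball x (\<sigma> * h) \<subseteq> K" using \<sigma>(2) K by blast
    then have "ball x (\<sigma> * h) \<subseteq> interior K"
      using ball_subset_cball by (intro interior_maximal) auto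
    moreover have "x \<in> ball x (\<sigma> * h)" using \<sigma>(1) h0 by simp
    ultimately show "interior K \<noteq> {}" by blast
  qed
  show "\<exists>u \<phi>. scheme_solution \<Omega> (fe_space \<Omega> (\<T> h) r) \<alpha> \<beta> (T / real N) N u0 \<phi>0 u \<phi>"
    by (rule scheme_solution_exists) (use assms(3,4,6,7,8) N in auto)
qed

end
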